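(* Let $X$ and $Y$ be essentially incomparable Banach spaces and put $Z=X\oplus Y$. If $$U=\begin{pmatrix} U_{11} & U_{12} \\ U_{21} & U_{22} \end{pmatrix}\in\mathcal B(Z)$$ is Fredholm, then $U_{11}$ and $U_{22}$ are Fredholm and $$\operatorname{ind}U=\operatorname{ind}U_{11}+\operatorname{ind}U_{22}.$$ In particular, $$\varphi:\operatorname{Inv}(\mathcal B(Z))\longrightarrow\mathbb Z,\qquad \varphi(U)=\operatorname{ind}U_{11},$$ is a continuous group homomorphism, where $\mathbb Z$ is written additively.
   Context: Banach spaces are complex. $\mathcal B(X,Y)$ is the space of bounded operators $X\to Y$, $\mathcal B(X)=\mathcal B(X,X)$. An operator is Fredholm if it has closed range, finite-dimensional kernel and range of finite codimension; its index is $\operatorname{ind}T=\dim\operatorname{Ker}T-\dim(\text{codomain}/\operatorname{Ran}T)$. An operator $R\in\mathcal B(X,Y)$ is inessential if $I_X-VR$ is Fredholm for every $V\in\mathcal B(Y,X)$; the set of these is $\mathcal E(X,Y)$. $X$ and $Y$ are essentially incomparable if $\mathcal B(X,Y)=\mathcal E(X,Y)$ and $\mathcal B(Y,X)=\mathcal E(Y,X)$. Operators on $X\oplus Y$ are written as $2\times2$ operator matrices with respect to this decomposition. $\operatorname{Inv}(\mathcal B(Z))$ is the group of invertible operators with the norm topology; $\mathbb Z$ is discrete. *)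

theory Defs
  imports "HOL-Analysis.Analysis" "HOL-Library.Set_Algebras" "HOL-Algebra.Elementary_Groups"
begin

section \<open>Complex Banach spaces\<close>

text \<open>The law \<open>1 *\<^sub>C x = x\<close> is not listed because it follows from \<open>scaleR_scaleC\<close>.\<close>

class complex_normed_vector = real_normed_vector +
  fixes scaleC :: "complex \<Rightarrow> 'a \<Rightarrow> 'a" (infixr "*\<^sub>C" 75)
  assumes scaleR_scaleC: "r *\<^sub>R x = complex_of_real r *\<^sub>C x"
    and scaleC_add_right: "c *\<^sub>C (x + y) = c *\<^sub>C x + c *\<^sub>C y"
    and scaleC_add_left: "(c + d) *\<^sub>C x = c *\<^sub>C x + d *\<^sub>C x"
    and scaleC_scaleC: "c *\<^sub>C d *\<^sub>C x = (c * d) *\<^sub>C x"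
    and norm_scaleC: "norm (c *\<^sub>C x) = cmod c * norm x"

lemma scaleC_one [simp]: "1 *\<^sub>C x = (x :: 'a::complex_normed_vector)"
  using scaleR_scaleC[of 1 x] by simp

class cbanach = complex_normed_vector + complete_space

subclass (in cbanach) banach ..

global_interpretation complex_vector:
  vector_space "scaleC :: complex \<Rightarrow> 'a \<Rightarrow> 'a::complex_normed_vector"
  defines cspan = complex_vector.span
    and csubspace = complex_vector.subspace
    and cdependent = complex_vector.dependent
    and cdim = complex_vector.dim
  by unfold_locales (simp_all add: scaleC_add_right scaleC_add_left scaleC_scaleC)

instantiation prod :: (complex_normed_vector, complex_normed_vector) complex_normed_vector
begin

definition scaleC_prod :: "complex \<Rightarrow> 'a \<times> 'b \<Rightarrow> 'a \<times> 'b"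
  where "scaleC_prod c z = (c *\<^sub>C fst z, c *\<^sub>C snd z)"

instance
proof
  fix c d :: complex and r :: real and x y :: "'a \<times> 'b"
  show "r *\<^sub>R x = complex_of_real r *\<^sub>C x"
    by (simp add: scaleC_prod_def scaleR_prod_def scaleR_scaleC)
  show "c *\<^sub>C (x + y) = c *\<^sub>C x + c *\<^sub>C y"
    by (simp add: scaleC_prod_def scaleC_add_right)
  show "(c + d) *\<^sub>C x = c *\<^sub>C x + d *\<^sub>C x"
    by (simp add: scaleC_prod_def scaleC_add_left)
  show "c *\<^sub>C d *\<^sub>C x = (c * d) *\<^sub>C x"
    by (simp add: scaleC_prod_def scaleC_scaleC)
  have "norm (c *\<^sub>C x) = sqrt ((cmod c)\<^sup>2 * ((norm (fst x))\<^sup>2 + (norm (snd x))\<^sup>2))"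
    by (simp add: scaleC_prod_def norm_prod_def norm_scaleC power_mult_distrib distrib_left)
  then show "norm (c *\<^sub>C x) = cmod c * norm x"
    by (simp add: norm_prod_def real_sqrt_mult)
qed

end

instance prod :: (cbanach, cbanach) cbanach ..

section \<open>Bounded complex-linear operators\<close>

text \<open>The type \<open>'a \<Rightarrow>\<^sub>L 'b\<close> consists of the bounded real-linear operators with the operator norm;
  \<open>\<B>(X, Y)\<close> is its subspace of complex-linear operators.\<close>

definition cblinops :: "('a::complex_normed_vector \<Rightarrow>\<^sub>L 'b::complex_normed_vector) set"
  where "cblinops = {T. \<forall>c x. blinfun_apply T (c *\<^sub>C x) = c *\<^sub>C blinfun_apply T x}"

section \<open>Quotient spaces and codimension\<close>

text \<open>Addition of sets is elementwise, so that \<open>(x + W) + (y + W) = (x + y) + W\<close>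
  for a subspace \<open>W\<close>.\<close>

definition quotient_space :: "'a::complex_normed_vector set \<Rightarrow> 'a set set"
  where "quotient_space W = range (\<lambda>x. {x} + W)"

text \<open>Adding \<open>W\<close> only matters for \<open>c = 0\<close>, where the result has to be \<open>W\<close> and not \<open>{0}\<close>.\<close>

definition coset_scale :: "'a::complex_normed_vector set \<Rightarrow> complex \<Rightarrow> 'a set \<Rightarrow> 'a set"
  where "coset_scale W c A = scaleC c ` A + W"

text \<open>The final \<open>+ W\<close> is absorbed unless \<open>C\<close> is empty; in that case the sum of sets is \<open>{0}\<close>,
  while the zero of the quotient is \<open>W\<close>.\<close>

definition quotient_lincomb ::
    "'a::complex_normed_vector set \<Rightarrow> ('a set \<Rightarrow> complex) \<Rightarrow> 'a set set \<Rightarrow> 'a set"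
  where "quotient_lincomb W c C = (\<Sum>A\<in>C. coset_scale W (c A) A) + W"

definition finite_quotient_basis :: "'a::complex_normed_vector set \<Rightarrow> 'a set set \<Rightarrow> bool"
  where "finite_quotient_basis W C \<longleftrightarrow>
    finite C \<and> C \<subseteq> quotient_space W \<and>
    (\<forall>c. quotient_lincomb W c C = W \<longrightarrow> (\<forall>A\<in>C. c A = 0)) \<and>
    (\<forall>D\<in>quotient_space W. \<exists>c. D = quotient_lincomb W c C)"

definition finite_codim :: "'a::complex_normed_vector set \<Rightarrow> bool"
  where "finite_codim W \<longleftrightarrow> (\<exists>C. finite_quotient_basis W C)"

definition codim :: "'a::complex_normed_vector set \<Rightarrow> nat"
  where "codim W = (if finite_codim W then card (SOME C. finite_quotient_basis W C) else 0)"

section \<open>Fredholm and inessential operators\<close>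

definition ker :: "('a::complex_normed_vector \<Rightarrow>\<^sub>L 'b::complex_normed_vector) \<Rightarrow> 'a set"
  where "ker T = {x. blinfun_apply T x = 0}"

definition fredholm :: "('a::complex_normed_vector \<Rightarrow>\<^sub>L 'b::complex_normed_vector) \<Rightarrow> bool"
  where "fredholm T \<longleftrightarrow>
    T \<in> cblinops \<and>
    closed (range (blinfun_apply T)) \<and>
    (\<exists>B. finite B \<and> ker T = cspan B) \<and>
    finite_codim (range (blinfun_apply T))"

definition ind :: "('a::complex_normed_vector \<Rightarrow>\<^sub>L 'b::complex_normed_vector) \<Rightarrow> int"
  where "ind T = int (cdim (ker T)) - int (codim (range (blinfun_apply T)))"

definition inessential_ops :: "('a::complex_normed_vector \<Rightarrow>\<^sub>L 'b::complex_normed_vector) set"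
  where "inessential_ops =
    {R \<in> cblinops. \<forall>V\<in>cblinops. fredholm (id_blinfun - (V o\<^sub>L R))}"

definition essentially_incomparable :: "'a::cbanach itself \<Rightarrow> 'b::cbanach itself \<Rightarrow> bool"
  where "essentially_incomparable X Y \<longleftrightarrow>
    (cblinops :: ('a \<Rightarrow>\<^sub>L 'b) set) = inessential_ops \<and>
    (cblinops :: ('b \<Rightarrow>\<^sub>L 'a) set) = inessential_ops"

section \<open>Operator matrices\<close>

definition inl_blinfun :: "'a::real_normed_vector \<Rightarrow>\<^sub>L ('a \<times> 'b::real_normed_vector)"
  where "inl_blinfun = Blinfun (\<lambda>x. (x, 0))"

definition inr_blinfun :: "'b::real_normed_vector \<Rightarrow>\<^sub>L ('a::real_normed_vector \<times> 'b)"
  where "inr_blinfun = Blinfun (\<lambda>y. (0, y))"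

lemma inl_blinfun_apply [simp]: "blinfun_apply inl_blinfun x = (x, 0)"
  unfolding inl_blinfun_def
  by (subst bounded_linear_Blinfun_apply)
    (auto intro: bounded_linear_Pair bounded_linear_ident bounded_linear_zero)

lemma inr_blinfun_apply [simp]: "blinfun_apply inr_blinfun y = (0, y)"
  unfolding inr_blinfun_def
  by (subst bounded_linear_Blinfun_apply)
    (auto intro: bounded_linear_Pair bounded_linear_ident bounded_linear_zero)

context
  fixes U :: "('a::real_normed_vector \<times> 'b::real_normed_vector) \<Rightarrow>\<^sub>L ('a \<times> 'b)"
begin

definition entry11 :: "'a \<Rightarrow>\<^sub>L 'a" where "entry11 = fst_blinfun o\<^sub>L U o\<^sub>L inl_blinfun"
definition entry12 :: "'b \<Rightarrow>\<^sub>L 'a" where "entry12 = fst_blinfun o\<^sub>L U o\<^sub>L inr_blinfun"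
definition entry21 :: "'a \<Rightarrow>\<^sub>L 'b" where "entry21 = snd_blinfun o\<^sub>L U o\<^sub>L inl_blinfun"
definition entry22 :: "'b \<Rightarrow>\<^sub>L 'b" where "entry22 = snd_blinfun o\<^sub>L U o\<^sub>L inr_blinfun"

lemma operator_matrix:
  "blinfun_apply U (x, y) =
    (blinfun_apply entry11 x + blinfun_apply entry12 y,
     blinfun_apply entry21 x + blinfun_apply entry22 y)"
proof -
  have "blinfun_apply U (x, y) = blinfun_apply U (x, 0) + blinfun_apply U (0, y)"
    by (simp flip: blinfun.add_right)
  then show ?thesis
    by (simp add: entry11_def entry12_def entry21_def entry22_def prod_eq_iff
        fst_blinfun.rep_eq snd_blinfun.rep_eq)
qed

end

section \<open>The group of invertible operators\<close>

definition op_monoid :: "('a::complex_normed_vector \<Rightarrow>\<^sub>L 'a) monoid"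
  where "op_monoid = \<lparr>carrier = cblinops, mult = (o\<^sub>L), one = id_blinfun\<rparr>"

definition Inv :: "('a::complex_normed_vector \<Rightarrow>\<^sub>L 'a) monoid"
  where "Inv = units_of op_monoid"

end

theory Submission
  imports Defs
begin

text \<open>An operator \<open>T\<close> is Fredholm exactly if it is invertible modulo finite-rank operators: there is a bounded
\<open>S\<close>, a parametrix, with \<open>1 - S T\<close> and \<open>1 - T S\<close> of finite rank (\<open>fredholm_parametrix\<close>,
\<open>fredholmI\<close>). With this description the statement becomes a computation with operator matrices.

If \<open>V\<close> is a parametrix of \<open>U\<close>, the upper left entries of \<open>V U\<close> and \<open>U V\<close> say that \<open>V11 U11\<close> is
\<open>1 - V12 U21\<close> and \<open>U11 V11\<close> is \<open>1 - U12 V21\<close>, both up to finite rank. As \<open>U21\<close> and \<open>V21\<close> are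
inessential, both products are Fredholm, and hence so is \<open>U11\<close> (\<open>fredholm_corner\<close>). The other corner
is treated in the same way.

For the index let \<open>W\<close> and \<open>S\<close> be parametrices of \<open>U11\<close> and \<open>U22\<close>. Up to finite rank,
\<open>diag(W, S) U\<close> is a matrix with unit diagonal and off-diagonal entries \<open>A\<close> and \<open>B\<close>, which factors as
a lower triangular matrix times \<open>diag(1, 1 - B A)\<close> times an upper triangular matrix. The triangular
factors are invertible, so everything reduces to \<open>ind (1 - B A) = 0\<close> (\<open>ind_unit_diagonal_matrix\<close>),
and \<open>ind W = - ind U11\<close>, \<open>ind S = - ind U22\<close> give the formula. The vanishing of
\<open>ind (1 - V R)\<close> for inessential \<open>R\<close> is a homotopy argument: every \<open>1 - t V R\<close> with \<open>0 \<le> t \<le> 1\<close> is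
Fredholm and the index is locally constant (\<open>inessential_index\<close>, \<open>fredholm_index_stable\<close>).

The map \<open>\<phi>\<close> is a homomorphism because the upper left entry of \<open>U V\<close> is \<open>U11 V11 + U12 V21\<close>, whose
second summand does not change the index (\<open>ind_inessential_perturbation\<close>), and it is continuous because
the index is locally constant.

The Fredholm theory that this needs rests on two foundations. The algebraic one is a calculus of
dimensions \<open>dim (L / M)\<close> for subspaces \<open>M \<subseteq> L\<close>, which gives the additivity of the index under
composition (\<open>ind_compose\<close>) and \<open>ind (1 - F) = 0\<close> for \<open>F\<close> of finite rank
(\<open>ind_id_minus_finite_rank\<close>). The analytic one consists of the Hahn-Banach theorem, which provides
bounded projections with finite-dimensional range (\<open>finite_rank_projection\<close>), and of the open
mapping theorem (\<open>open_mapping_bound\<close>); the two together produce parametrices.\<close>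

section \<open>Dimensions of quotients of subspaces\<close>

text \<open>Linear independence of the cosets of the elements of \<open>B\<close> in the quotient by \<open>M\<close>. Working with
representatives avoids a type of quotient spaces.\<close>

definition indep_mod :: "'a::complex_normed_vector set \<Rightarrow> 'a set \<Rightarrow> bool"
  where "indep_mod M B \<longleftrightarrow> finite B \<and> (\<forall>c. (\<Sum>b\<in>B. c b *\<^sub>C b) \<in> M \<longrightarrow> (\<forall>b\<in>B. c b = 0))"

text \<open>The cosets of \<open>B\<close> form a finite basis of \<open>L / M\<close>.\<close>

definition rel_basis :: "'a::complex_normed_vector set \<Rightarrow> 'a set \<Rightarrow> 'a set \<Rightarrow> bool"
  where "rel_basis M L B \<longleftrightarrow> csubspace M \<and> indep_mod M B \<and> L = cspan (M \<union> B)"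

definition fin_quot :: "'a::complex_normed_vector set \<Rightarrow> 'a set \<Rightarrow> bool"
  where "fin_quot M L \<longleftrightarrow> (\<exists>B. rel_basis M L B)"

definition qdim :: "'a::complex_normed_vector set \<Rightarrow> 'a set \<Rightarrow> nat"
  where "qdim M L = card (SOME B. rel_basis M L B)"

lemma indep_modD:
  assumes "indep_mod M B" "(\<Sum>b\<in>B. c b *\<^sub>C b) \<in> M" "b \<in> B"
  shows "c b = 0"
  using assms by (auto simp: indep_mod_def)

lemma cspan_Un_finite_iff:
  assumes "csubspace M" "finite B"
  shows "x \<in> cspan (M \<union> B) \<longleftrightarrow> (\<exists>c. x - (\<Sum>b\<in>B. c b *\<^sub>C b) \<in> M)"
proof -
  have "x \<in> cspan (M \<union> B) \<longleftrightarrow> (\<exists>m\<in>M. \<exists>c. x = m + (\<Sum>b\<in>B. c b *\<^sub>C b))"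
    using assms
    by (auto simp: complex_vector.span_Un complex_vector.span_finite complex_vector.span_eq_iff[THEN iffD2])
  also have "\<dots> \<longleftrightarrow> (\<exists>c. x - (\<Sum>b\<in>B. c b *\<^sub>C b) \<in> M)"
    by (metis add_diff_cancel_right' diff_add_cancel)
  finally show ?thesis .
qed

lemma cspan_cspan_Un: "cspan (cspan A \<union> B) = cspan (A \<union> B)"
proof
  have "cspan A \<subseteq> cspan (A \<union> B)"
    by (intro complex_vector.span_mono) simp
  then show "cspan (cspan A \<union> B) \<subseteq> cspan (A \<union> B)"
    using complex_vector.span_superset[of "A \<union> B"]
    by (intro complex_vector.span_minimal complex_vector.subspace_span) simp
  show "cspan (A \<union> B) \<subseteq> cspan (cspan A \<union> B)"
    using complex_vector.span_superset[of A] by (intro complex_vector.span_mono) auto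
qed

lemma csum_in_cspan: "(\<Sum>b\<in>B. c b *\<^sub>C b) \<in> cspan B"
  by (intro complex_vector.span_sum complex_vector.span_scale complex_vector.span_base)

lemma rel_basisD:
  assumes "rel_basis M L B"
  shows "csubspace M" "finite B" "csubspace L" "M \<subseteq> L" "B \<subseteq> L"
  using assms complex_vector.span_superset[of "M \<union> B"]
  by (auto simp: rel_basis_def indep_mod_def)

lemma indep_mod_inj:
  assumes B: "indep_mod M B" and xy: "x \<in> B" "y \<in> B" "x - y \<in> M"
  shows "x = y"
proof (rule ccontr)
  assume "x \<noteq> y"
  define c :: "'a \<Rightarrow> complex" where "c = (\<lambda>z. (if z = x then 1 else 0) - (if z = y then 1 else 0))"
  have "(\<Sum>z\<in>B. c z *\<^sub>C z) = (\<Sum>z\<in>B. (if z = x then z else 0)) - (\<Sum>z\<in>B. (if z = y then z else 0))"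
    unfolding sum_subtractf[symmetric]
    by (rule sum.cong) (auto simp: c_def)
  also have "\<dots> = x - y"
    using B xy by (simp add: indep_mod_def)
  finally have "c x = 0"
    using indep_modD[OF B _ xy(1), of c] xy(3) by simp
  then show False
    using \<open>x \<noteq> y\<close> by (simp add: c_def)
qed

text \<open>The exchange lemma for \<open>L / M\<close>, reduced to the one for the finite set \<open>B\<close>: replacing every
\<open>x \<in> C\<close> by its component \<open>d x\<close> in the span of \<open>B\<close> changes it by an element of \<open>M\<close> only, so that
independence modulo \<open>M\<close> turns into independence of the \<open>d x\<close>.\<close>

lemma indep_mod_card_le:
  assumes M: "csubspace M" and B: "finite B" and C: "indep_mod M C" "C \<subseteq> cspan (M \<union> B)"
  shows "card C \<le> card B"
proof -
  have "\<forall>x\<in>C. \<exists>c. x - (\<Sum>b\<in>B. c b *\<^sub>C b) \<in> M"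
    using C(2) cspan_Un_finite_iff[OF M B] by blast
  then have "\<forall>x\<in>C. \<exists>d. d \<in> cspan B \<and> x - d \<in> M"
    using csum_in_cspan by blast
  then obtain d where d: "\<And>x. x \<in> C \<Longrightarrow> d x \<in> cspan B" "\<And>x. x \<in> C \<Longrightarrow> x - d x \<in> M"
    by metis
  have fC: "finite C"
    using C(1) by (simp add: indep_mod_def)
  \<comment> \<open>A relation between the \<open>d x\<close> is a relation modulo \<open>M\<close> between the \<open>x\<close>.\<close>
  have zero: "c x = 0" if "(\<Sum>x\<in>C. c x *\<^sub>C d x) = 0" "x \<in> C" for c x
  proof (rule indep_modD[OF C(1) _ \<open>x \<in> C\<close>])
    have "(\<Sum>x\<in>C. c x *\<^sub>C x) = (\<Sum>x\<in>C. c x *\<^sub>C (x - d x))"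
      using that(1) by (simp add: complex_vector.scale_right_diff_distrib sum_subtractf)
    also have "\<dots> \<in> M"
      by (intro complex_vector.subspace_sum complex_vector.subspace_scale M d)
    finally show "(\<Sum>x\<in>C. c x *\<^sub>C x) \<in> M" .
  qed
  have inj: "inj_on d C"
  proof (rule inj_onI)
    fix x y assume xy: "x \<in> C" "y \<in> C" "d x = d y"
    have "x - y = (x - d x) - (y - d y)"
      using xy(3) by simp
    also have "\<dots> \<in> M"
      by (rule complex_vector.subspace_diff[OF M d(2)[OF xy(1)] d(2)[OF xy(2)]])
    finally show "x = y"
      by (rule indep_mod_inj[OF C(1) xy(1,2)])
  qed
  have "\<not> cdependent (d ` C)"
  proof (rule complex_vector.independent_if_scalars_zero)
    fix f x assume "(\<Sum>x\<in>d ` C. f x *\<^sub>C x) = 0" "x \<in> d ` C"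
    then show "f x = 0"
      using zero[of "\<lambda>x. f (d x)"] by (auto simp: sum.reindex[OF inj])
  qed (use fC in simp)
  then have "card (d ` C) \<le> card B"
    using complex_vector.independent_span_bound[OF B, of "d ` C"] d(1) by auto
  then show ?thesis
    by (simp add: card_image[OF inj])
qed

lemma rel_basis_card_unique:
  assumes "rel_basis M L B" "rel_basis M L C"
  shows "card B = card C"
  using assms indep_mod_card_le[of M B C] indep_mod_card_le[of M C B] rel_basisD[OF assms(1)]
    rel_basisD[OF assms(2)]
  by (fastforce simp: rel_basis_def)

lemma qdim_eq: "rel_basis M L B \<Longrightarrow> qdim M L = card B"
  unfolding qdim_def by (metis rel_basis_card_unique someI)

lemma rel_basis_insert:
  assumes B: "rel_basis M L B" and x: "x \<notin> L"
  shows "rel_basis M (cspan (insert x L)) (insert x B)"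
proof -
  note rel_basisD[OF B]
  have "x \<notin> B" using x \<open>B \<subseteq> L\<close> by blast
  have "indep_mod M (insert x B)"
    unfolding indep_mod_def
  proof (intro conjI allI impI)
    show "finite (insert x B)" using \<open>finite B\<close> by simp
    fix c assume *: "(\<Sum>b\<in>insert x B. c b *\<^sub>C b) \<in> M"
    then have M: "c x *\<^sub>C x + (\<Sum>b\<in>B. c b *\<^sub>C b) \<in> M"
      using \<open>finite B\<close> \<open>x \<notin> B\<close> by simp
    have "(\<Sum>b\<in>B. c b *\<^sub>C b) \<in> L"
      using \<open>B \<subseteq> L\<close> \<open>csubspace L\<close>
      by (intro complex_vector.subspace_sum complex_vector.subspace_scale) auto
    with M have "c x *\<^sub>C x \<in> L"
      using \<open>M \<subseteq> L\<close> \<open>csubspace L\<close> complex_vector.subspace_diff[of L "c x *\<^sub>C x + (\<Sum>b\<in>B. c b *\<^sub>C b)" "\<Sum>b\<in>B. c b *\<^sub>C b"]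
      by auto
    then have cx: "c x = 0"
      using x complex_vector.subspace_scale[OF \<open>csubspace L\<close>, of "c x *\<^sub>C x" "inverse (c x)"]
      by (cases "c x = 0") (auto simp: scaleC_scaleC)
    with M have "\<forall>b\<in>B. c b = 0"
      using B by (auto simp: rel_basis_def indep_mod_def)
    then show "\<forall>b\<in>insert x B. c b = 0"
      using cx by blast
  qed
  moreover have "cspan (insert x L) = cspan (M \<union> insert x B)"
    using B cspan_cspan_Un[of "M \<union> B" "{x}"] by (simp add: rel_basis_def)
  ultimately show ?thesis
    using B by (simp add: rel_basis_def)
qed

lemma rel_basis_empty: "csubspace M \<Longrightarrow> rel_basis M M {}"
  by (simp add: rel_basis_def indep_mod_def complex_vector.span_eq_iff[THEN iffD2])

lemma rel_basis_of_generators: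
  assumes M: "csubspace M" and B: "finite B"
  shows "\<exists>C\<subseteq>B. rel_basis M (cspan (M \<union> B)) C"
  using B
proof (induction B)
  case empty
  then show ?case
    using rel_basis_empty[OF M] M by (auto simp: complex_vector.span_eq_iff[THEN iffD2])
next
  case (insert x B)
  then obtain C where C: "C \<subseteq> B" "rel_basis M (cspan (M \<union> B)) C" by blast
  show ?case
  proof (cases "x \<in> cspan (M \<union> B)")
    case True
    then have "cspan (M \<union> insert x B) = cspan (M \<union> B)"
      using complex_vector.span_redundant by fastforce
    then show ?thesis using C by auto
  next
    case False
    have "cspan (insert x (cspan (M \<union> B))) = cspan (M \<union> insert x B)"
      using cspan_cspan_Un[of "M \<union> B" "{x}"] by simp
    then show ?thesis
      using rel_basis_insert[OF C(2) False] C(1) by (intro exI[of _ "insert x C"]) auto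
  qed
qed

lemma fin_quotI:
  assumes "csubspace M" "finite B" "L = cspan (M \<union> B)"
  shows "fin_quot M L"
  using rel_basis_of_generators[OF assms(1,2)] assms(3) by (auto simp: fin_quot_def)

text \<open>That \<open>K / M\<close> is again finite-dimensional is seen from a subset of \<open>K\<close> that is independent modulo \<open>M\<close>
and has the largest possible size, which is bounded by \<open>dim (L / M)\<close>.\<close>

lemma fin_quot_between:
  assumes fin: "fin_quot M L" and K: "csubspace K" "M \<subseteq> K" "K \<subseteq> L"
  shows "fin_quot M K" "fin_quot K L"
proof -
  obtain B where B: "rel_basis M L B" using fin by (auto simp: fin_quot_def)
  note BD = rel_basisD[OF B]
  have "L \<subseteq> cspan (K \<union> B)"
    using B K(2) complex_vector.span_mono[of "M \<union> B" "K \<union> B"] by (auto simp: rel_basis_def)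
  moreover have "cspan (K \<union> B) \<subseteq> L"
    using K(3) BD by (intro complex_vector.span_minimal) auto
  ultimately show "fin_quot K L"
    using fin_quotI[OF K(1) \<open>finite B\<close>] by blast
  define P where "P n \<longleftrightarrow> (\<exists>C. indep_mod M C \<and> C \<subseteq> K \<and> card C = n)" for n
  have "P 0"
    unfolding P_def by (rule exI[of _ "{}"]) (simp add: indep_mod_def)
  moreover have bound: "n \<le> card B" if "P n" for n
    using that indep_mod_card_le[OF BD(1,2)] K(3) B unfolding P_def rel_basis_def by blast
  ultimately obtain n where n: "P n" "\<And>k. P k \<Longrightarrow> k \<le> n"
    using ex_has_greatest_nat[of P 0 "\<lambda>k. k" "Suc (card B)"] by (auto simp: le_imp_less_Suc)
  then obtain C where C: "indep_mod M C" "C \<subseteq> K" "card C = n" unfolding P_def by blast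
  have C': "rel_basis M (cspan (M \<union> C)) C" using C(1) BD(1) by (simp add: rel_basis_def)
  have "K \<subseteq> cspan (M \<union> C)"
  proof (rule ccontr)
    assume "\<not> K \<subseteq> cspan (M \<union> C)"
    then obtain x where x: "x \<in> K" "x \<notin> cspan (M \<union> C)" by blast
    from rel_basis_insert[OF C' x(2)] have "indep_mod M (insert x C)" by (simp add: rel_basis_def)
    moreover have "card (insert x C) = Suc n"
      using C rel_basisD[OF C'] x(2) by (metis card_insert_disjoint subsetD)
    ultimately have "P (Suc n)" using x(1) C(2) unfolding P_def by blast
    then show False using n(2) by fastforce
  qed
  moreover have "cspan (M \<union> C) \<subseteq> K"
    using C(2) K by (intro complex_vector.span_minimal) auto
  ultimately show "fin_quot M K" using C' unfolding fin_quot_def by (metis subset_antisym)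
qed

lemma fin_quotD:
  assumes "fin_quot M L"
  shows "csubspace M" "csubspace L" "M \<subseteq> L"
  using assms rel_basisD unfolding fin_quot_def by blast+

lemma qdim_refl: "csubspace M \<Longrightarrow> qdim M M = 0"
  using rel_basis_empty qdim_eq by fastforce

text \<open>Putting together a basis of \<open>K / M\<close> and one of \<open>L / K\<close> gives a basis of \<open>L / M\<close>.\<close>

lemma quotient_tower:
  assumes "fin_quot M K" "fin_quot K L"
  shows "fin_quot M L" "qdim M L = qdim M K + qdim K L"
proof -
  obtain B C where B: "rel_basis M K B" and C: "rel_basis K L C"
    using assms by (auto simp: fin_quot_def)
  note BD = rel_basisD[OF B] and CD = rel_basisD[OF C]
  have disj: "B \<inter> C = {}"
  proof (rule ccontr)
    assume "B \<inter> C \<noteq> {}"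
    then obtain x where x: "x \<in> C" "x \<in> K" using BD by blast
    have "(\<Sum>b\<in>C. (if b = x then 1 else 0) *\<^sub>C b) = (\<Sum>b\<in>C. (if b = x then b else 0))"
      by (rule sum.cong) auto
    also have "\<dots> = x"
      using x(1) CD(2) by simp
    finally have "(if x = x then 1 else 0) = (0::complex)"
      using x C indep_modD[of K C "\<lambda>b. if b = x then 1 else 0" x] by (simp add: rel_basis_def)
    then show False by simp
  qed
  have "indep_mod M (B \<union> C)"
    unfolding indep_mod_def
  proof (intro conjI allI impI)
    show "finite (B \<union> C)" using BD CD by simp
    fix c assume "(\<Sum>b\<in>B \<union> C. c b *\<^sub>C b) \<in> M"
    then have M: "(\<Sum>b\<in>B. c b *\<^sub>C b) + (\<Sum>b\<in>C. c b *\<^sub>C b) \<in> M"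
      using BD CD disj by (simp add: sum.union_disjoint)
    have "(\<Sum>b\<in>B. c b *\<^sub>C b) \<in> K"
      using BD by (intro complex_vector.subspace_sum complex_vector.subspace_scale) auto
    then have "(\<Sum>b\<in>C. c b *\<^sub>C b) \<in> K"
      using M BD complex_vector.subspace_diff[of K "(\<Sum>b\<in>B. c b *\<^sub>C b) + (\<Sum>b\<in>C. c b *\<^sub>C b)" "\<Sum>b\<in>B. c b *\<^sub>C b"] by auto
    then have c0: "\<forall>b\<in>C. c b = 0"
      using C by (auto simp: rel_basis_def indep_mod_def)
    then have "(\<Sum>b\<in>B. c b *\<^sub>C b) \<in> M"
      using M by simp
    then show "\<forall>b\<in>B \<union> C. c b = 0"
      using B c0 by (auto simp: rel_basis_def indep_mod_def)
  qed
  moreover have "L = cspan (M \<union> (B \<union> C))"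
    using B C cspan_cspan_Un[of "M \<union> B" C] by (simp add: rel_basis_def Un_assoc)
  ultimately have BC: "rel_basis M L (B \<union> C)"
    using B by (simp add: rel_basis_def)
  then show "fin_quot M L" by (auto simp: fin_quot_def)
  show "qdim M L = qdim M K + qdim K L"
    using qdim_eq[OF B] qdim_eq[OF C] qdim_eq[OF BC] BD CD disj by (simp add: card_Un_disjoint)
qed

lemma cblinops_closure [intro, simp]:
  "id_blinfun \<in> cblinops" "0 \<in> cblinops"
  "S \<in> cblinops \<Longrightarrow> T \<in> cblinops \<Longrightarrow> S + T \<in> cblinops"
  "S \<in> cblinops \<Longrightarrow> T \<in> cblinops \<Longrightarrow> S - T \<in> cblinops"
  "S \<in> cblinops \<Longrightarrow> - S \<in> cblinops"
  "A \<in> cblinops \<Longrightarrow> B \<in> cblinops \<Longrightarrow> A o\<^sub>L B \<in> cblinops"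
  "S \<in> cblinops \<Longrightarrow> r *\<^sub>R S \<in> cblinops"
  by (simp_all add: cblinops_def blinfun.bilinear_simps scaleC_add_right scaleR_scaleC scaleC_scaleC
      mult.commute complex_vector.scale_right_diff_distrib)

lemma cblinops_scaleC: "T \<in> cblinops \<Longrightarrow> blinfun_apply T (c *\<^sub>C x) = c *\<^sub>C blinfun_apply T x"
  by (simp add: cblinops_def)

lemma cblinops_sum:
  assumes "T \<in> cblinops"
  shows "blinfun_apply T (\<Sum>b\<in>B. c b *\<^sub>C f b) = (\<Sum>b\<in>B. c b *\<^sub>C blinfun_apply T (f b))"
  by (simp add: blinfun.sum_right cblinops_scaleC[OF assms])

lemma csubspace_image: "T \<in> cblinops \<Longrightarrow> csubspace M \<Longrightarrow> csubspace (blinfun_apply T ` M)"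
  unfolding complex_vector.subspace_def
  by (auto simp: image_iff) (metis blinfun.zero_right blinfun.add_right cblinops_scaleC)+

lemma csubspace_vimage:
  assumes "T \<in> cblinops" "csubspace M" shows "csubspace (blinfun_apply T -` M)"
  using assms unfolding complex_vector.subspace_def
  by (auto simp: blinfun.zero_right blinfun.add_right cblinops_scaleC)

lemma cspan_image:
  assumes T: "T \<in> cblinops"
  shows "blinfun_apply T ` cspan S = cspan (blinfun_apply T ` S)"
proof
  have "cspan S \<subseteq> blinfun_apply T -` cspan (blinfun_apply T ` S)"
    by (rule complex_vector.span_minimal)
      (auto intro: complex_vector.span_base csubspace_vimage[OF T])
  then show "blinfun_apply T ` cspan S \<subseteq> cspan (blinfun_apply T ` S)" by blast
  show "cspan (blinfun_apply T ` S) \<subseteq> blinfun_apply T ` cspan S"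
    by (rule complex_vector.span_minimal)
      (auto intro: complex_vector.span_base csubspace_image[OF T])
qed

text \<open>An operator whose kernel in \<open>L\<close> is contained in \<open>M\<close> induces an isomorphism from \<open>L / M\<close> to
\<open>T L / T M\<close>. Kernels and ranges are compared by means of this lemma and the next one.\<close>

lemma quotient_image:
  assumes T: "T \<in> cblinops" and fin: "fin_quot M L" and ker: "\<And>x. x \<in> L \<Longrightarrow> blinfun_apply T x = 0 \<Longrightarrow> x \<in> M"
  shows "fin_quot (blinfun_apply T ` M) (blinfun_apply T ` L)"
    "qdim (blinfun_apply T ` M) (blinfun_apply T ` L) = qdim M L"
proof -
  obtain B where B: "rel_basis M L B" using fin by (auto simp: fin_quot_def)
  note BD = rel_basisD[OF B]
  have zero: "\<forall>b\<in>B. c b = 0" if "(\<Sum>b\<in>B. c b *\<^sub>C blinfun_apply T b) \<in> blinfun_apply T ` M" for c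
  proof -
    note * = that
    obtain m where m: "m \<in> M" "blinfun_apply T (\<Sum>b\<in>B. c b *\<^sub>C b) = blinfun_apply T m"
      using * cblinops_sum[OF T, of c "\<lambda>b. b" B] by auto
    have "(\<Sum>b\<in>B. c b *\<^sub>C b) - m \<in> L"
      using BD m by (intro complex_vector.subspace_diff complex_vector.subspace_sum complex_vector.subspace_scale) auto
    then have "(\<Sum>b\<in>B. c b *\<^sub>C b) - m \<in> M"
      using m(2) by (intro ker) (auto simp: blinfun.diff_right)
    then have "(\<Sum>b\<in>B. c b *\<^sub>C b) \<in> M"
      using m(1) BD(1) complex_vector.subspace_add by fastforce
    then show ?thesis using B by (auto simp: rel_basis_def indep_mod_def)
  qed
  have inj: "inj_on (blinfun_apply T) B"
  proof (rule inj_onI)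
    fix x y assume xy: "x \<in> B" "y \<in> B" "blinfun_apply T x = blinfun_apply T y"
    have "x - y \<in> L"
      using xy BD(3,5) complex_vector.subspace_diff by blast
    then have "x - y \<in> M"
      using xy(3) by (intro ker) (auto simp: blinfun.diff_right)
    then show "x = y"
      using indep_mod_inj[of M B x y] xy B by (simp add: rel_basis_def)
  qed
  have "indep_mod (blinfun_apply T ` M) (blinfun_apply T ` B)"
    unfolding indep_mod_def using zero[of "\<lambda>b. _ (blinfun_apply T b)"] BD(2)
    by (auto simp: sum.reindex[OF inj])
  then have TB: "rel_basis (blinfun_apply T ` M) (blinfun_apply T ` L) (blinfun_apply T ` B)"
    using B csubspace_image[OF T] unfolding rel_basis_def
    by (simp add: cspan_image[OF T] image_Un)
  then show "fin_quot (blinfun_apply T ` M) (blinfun_apply T ` L)"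
    by (auto simp: fin_quot_def)
  show "qdim (blinfun_apply T ` M) (blinfun_apply T ` L) = qdim M L"
    using qdim_eq[OF TB] qdim_eq[OF B] card_image[OF inj] by simp
qed

text \<open>The isomorphism of \<open>K / (K \<inter> M)\<close> with \<open>(M + K) / M\<close>; a basis of the former is a basis of the latter.\<close>

lemma quotient_sum:
  assumes M: "csubspace M" and K: "fin_quot (K \<inter> M) K"
  shows "fin_quot M (cspan (M \<union> K))" "qdim M (cspan (M \<union> K)) = qdim (K \<inter> M) K"
proof -
  obtain B where B: "rel_basis (K \<inter> M) K B" using K by (auto simp: fin_quot_def)
  note BD = rel_basisD[OF B]
  have "K \<subseteq> cspan (M \<union> B)"
    using B complex_vector.span_mono[of "(K \<inter> M) \<union> B" "M \<union> B"] unfolding rel_basis_def by blast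
  then have "cspan (M \<union> K) \<subseteq> cspan (M \<union> B)"
    using complex_vector.span_superset[of "M \<union> B"] by (intro complex_vector.span_minimal) auto
  moreover have "cspan (M \<union> B) \<subseteq> cspan (M \<union> K)"
    using BD by (intro complex_vector.span_mono) auto
  moreover have "(\<Sum>b\<in>B. c b *\<^sub>C b) \<in> K" for c
    using BD by (intro complex_vector.subspace_sum complex_vector.subspace_scale) auto
  ultimately have MB: "rel_basis M (cspan (M \<union> K)) B"
    using B M by (auto simp: rel_basis_def indep_mod_def)
  then show "fin_quot M (cspan (M \<union> K))" by (auto simp: fin_quot_def)
  show "qdim M (cspan (M \<union> K)) = qdim (K \<inter> M) K"
    using qdim_eq[OF MB] qdim_eq[OF B] by simp
qed

section \<open>Codimension and index as quotient dimensions\<close>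

lemma coset_iff: "z \<in> {x} + W \<longleftrightarrow> z - x \<in> (W :: 'a::ab_group_add set)"
  by (auto simp: set_plus_def) (metis add.commute diff_add_cancel)

lemma coset_eq_iff:
  assumes "csubspace W"
  shows "{x} + W = {y} + W \<longleftrightarrow> x - y \<in> W"
proof
  assume "{x} + W = {y} + W"
  then have "x \<in> {y} + W"
    using coset_iff[of x x W] complex_vector.subspace_0[OF assms] by simp
  then show "x - y \<in> W" by (simp only: coset_iff)
next
  assume xy: "x - y \<in> W"
  have "z - x \<in> W \<longleftrightarrow> z - y \<in> W" for z
    using complex_vector.subspace_add[OF assms xy, of "z - x"]
      complex_vector.subspace_diff[OF assms _ xy, of "z - y"] by auto
  then show "{x} + W = {y} + W"
    by (simp add: set_eq_iff coset_iff)
qed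

lemma coset_eq_self_iff: "csubspace W \<Longrightarrow> {x} + W = W \<longleftrightarrow> x \<in> W"
  using coset_eq_iff[of W x 0] by (simp flip: set_zero)

lemma coset_add:
  assumes "csubspace W"
  shows "({x} + W) + ({y} + W) = {x + y} + W"
proof -
  have "W + W = W"
    using complex_vector.subspace_add[OF assms] complex_vector.subspace_0[OF assms]
    by (force simp: set_plus_def)
  have "({x} + W) + ({y} + W) = ({x} + {y}) + (W + W)"
    by (simp only: add.assoc add.left_commute)
  also have "{x} + {y} = {x + y}"
    by (auto simp: set_plus_def)
  finally show ?thesis
    by (simp add: \<open>W + W = W\<close>)
qed

lemma coset_scale_coset:
  assumes "csubspace W"
  shows "coset_scale W k ({x} + W) = {k *\<^sub>C x} + W"
proof (rule equalityI; rule subsetI)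
  fix z assume "z \<in> coset_scale W k ({x} + W)"
  then obtain w w' where "w \<in> W" "w' \<in> W" "z = k *\<^sub>C (x + w) + w'"
    by (auto simp: coset_scale_def set_plus_def)
  then show "z \<in> {k *\<^sub>C x} + W"
    using assms by (auto simp: coset_iff scaleC_add_right
        intro!: complex_vector.subspace_add complex_vector.subspace_scale)
next
  fix z assume "z \<in> {k *\<^sub>C x} + W"
  then obtain w where "w \<in> W" "z = k *\<^sub>C x + w"
    by (auto simp: set_plus_def)
  moreover have "x \<in> {x} + W"
    using complex_vector.subspace_0[OF assms] by (simp add: coset_iff)
  ultimately show "z \<in> coset_scale W k ({x} + W)"
    by (auto simp: coset_scale_def)
qed

lemma quotient_lincomb_cosets:
  assumes W: "csubspace W" and B: "finite B" and inj: "inj_on (\<lambda>b. {b} + W) B"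
  shows "quotient_lincomb W c ((\<lambda>b. {b} + W) ` B) = {\<Sum>b\<in>B. c ({b} + W) *\<^sub>C b} + W"
proof -
  have "(\<Sum>b\<in>B. coset_scale W (c ({b} + W)) ({b} + W)) + W = {\<Sum>b\<in>B. c ({b} + W) *\<^sub>C b} + W"
    using B
  proof induction
    case empty
    then show ?case by simp
  next
    case (insert x B)
    have "(\<Sum>b\<in>insert x B. coset_scale W (c ({b} + W)) ({b} + W)) + W
        = ({c ({x} + W) *\<^sub>C x} + W) + ((\<Sum>b\<in>B. coset_scale W (c ({b} + W)) ({b} + W)) + W)"
      using insert.hyps by (simp add: coset_scale_coset[OF W] add.assoc)
    also have "\<dots> = ({c ({x} + W) *\<^sub>C x} + W) + ({\<Sum>b\<in>B. c ({b} + W) *\<^sub>C b} + W)"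
      by (simp only: insert.IH)
    also have "\<dots> = {\<Sum>b\<in>insert x B. c ({b} + W) *\<^sub>C b} + W"
      using insert.hyps by (simp add: coset_add[OF W])
    finally show ?case .
  qed
  then show ?thesis
    by (simp add: quotient_lincomb_def sum.reindex[OF inj])
qed

text \<open>By injectivity, bases of \<open>UNIV / W\<close> that consist of cosets and those that consist of representatives
have the same size.\<close>

lemma rel_basis_inj_coset:
  assumes "rel_basis W L B"
  shows "inj_on (\<lambda>b. {b} + W) B"
proof (rule inj_onI)
  fix x y assume "x \<in> B" "y \<in> B" "{x} + W = {y} + W"
  then show "x = y"
    using indep_mod_inj[of W B x y] coset_eq_iff[OF rel_basisD(1)[OF assms]] assms
    by (simp add: rel_basis_def)
qed

text \<open>Coefficients are attached to cosets in one notion of basis and to representatives in the other; as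
\<open>B\<close> contains one representative of each coset in question, they can be transported in both
directions.\<close>

lemma finite_quotient_basis_cosets_iff:
  assumes W: "csubspace W" and inj: "inj_on (\<lambda>b. {b} + W) B"
  shows "finite_quotient_basis W ((\<lambda>b. {b} + W) ` B) \<longleftrightarrow> rel_basis W UNIV B"
proof (cases "finite B")
  case True
  have ext: "\<exists>d. \<forall>b\<in>B. c b = d ({b} + W)" for c :: "'a \<Rightarrow> complex"
    by (rule exI[of _ "\<lambda>A. c (inv_into B (\<lambda>b. {b} + W) A)"]) (simp add: inv_into_f_f[OF inj])
  have "(\<forall>c. quotient_lincomb W c ((\<lambda>b. {b} + W) ` B) = W \<longrightarrow> (\<forall>A\<in>(\<lambda>b. {b} + W) ` B. c A = 0))
      \<longleftrightarrow> (\<forall>c. (\<Sum>b\<in>B. c ({b} + W) *\<^sub>C b) \<in> W \<longrightarrow> (\<forall>b\<in>B. c ({b} + W) = 0))"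
    by (simp add: quotient_lincomb_cosets[OF W True inj] coset_eq_self_iff[OF W])
  also have "\<dots> \<longleftrightarrow> (\<forall>c. (\<Sum>b\<in>B. c b *\<^sub>C b) \<in> W \<longrightarrow> (\<forall>b\<in>B. c b = 0))"
  proof (intro iffI allI impI)
    fix c assume *: "\<forall>c. (\<Sum>b\<in>B. c ({b} + W) *\<^sub>C b) \<in> W \<longrightarrow> (\<forall>b\<in>B. c ({b} + W) = 0)"
      and c: "(\<Sum>b\<in>B. c b *\<^sub>C b) \<in> W"
    obtain d where d: "\<forall>b\<in>B. c b = d ({b} + W)" using ext by blast
    have "(\<Sum>b\<in>B. c b *\<^sub>C b) = (\<Sum>b\<in>B. d ({b} + W) *\<^sub>C b)"
      using d by (intro sum.cong) auto
    then have "\<forall>b\<in>B. d ({b} + W) = 0" using * c by simp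
    then show "\<forall>b\<in>B. c b = 0" using d by simp
  next
    fix c assume *: "\<forall>c. (\<Sum>b\<in>B. c b *\<^sub>C b) \<in> W \<longrightarrow> (\<forall>b\<in>B. c b = 0)"
      "(\<Sum>b\<in>B. c ({b} + W) *\<^sub>C b) \<in> W"
    then show "\<forall>b\<in>B. c ({b} + W) = 0"
      using spec[OF *(1), of "\<lambda>b. c ({b} + W)"] by simp
  qed
  finally have 1: "(\<forall>c. quotient_lincomb W c ((\<lambda>b. {b} + W) ` B) = W \<longrightarrow> (\<forall>A\<in>(\<lambda>b. {b} + W) ` B. c A = 0))
     \<longleftrightarrow> indep_mod W B"
    using True by (simp add: indep_mod_def)
  have "(\<forall>D\<in>quotient_space W. \<exists>c. D = quotient_lincomb W c ((\<lambda>b. {b} + W) ` B))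
      \<longleftrightarrow> (\<forall>x. \<exists>c. x - (\<Sum>b\<in>B. c ({b} + W) *\<^sub>C b) \<in> W)"
    by (simp add: quotient_space_def quotient_lincomb_cosets[OF W True inj] coset_eq_iff[OF W])
  also have "\<dots> \<longleftrightarrow> (\<forall>x. \<exists>c. x - (\<Sum>b\<in>B. c b *\<^sub>C b) \<in> W)"
  proof (intro iffI allI)
    fix x assume *: "\<forall>x. \<exists>c. x - (\<Sum>b\<in>B. c b *\<^sub>C b) \<in> W"
    then obtain c where c: "x - (\<Sum>b\<in>B. c b *\<^sub>C b) \<in> W" by blast
    obtain d where d: "\<forall>b\<in>B. c b = d ({b} + W)" using ext by blast
    have "(\<Sum>b\<in>B. c b *\<^sub>C b) = (\<Sum>b\<in>B. d ({b} + W) *\<^sub>C b)"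
      using d by (intro sum.cong) auto
    then show "\<exists>c. x - (\<Sum>b\<in>B. c ({b} + W) *\<^sub>C b) \<in> W" using c by auto
  next
    fix x assume *: "\<forall>x. \<exists>c. x - (\<Sum>b\<in>B. c ({b} + W) *\<^sub>C b) \<in> W"
    then obtain c where "x - (\<Sum>b\<in>B. c ({b} + W) *\<^sub>C b) \<in> W" by blast
    then show "\<exists>c. x - (\<Sum>b\<in>B. c b *\<^sub>C b) \<in> W"
      by (rule exI[of _ "\<lambda>b. c ({b} + W)"])
  qed
  also have "\<dots> \<longleftrightarrow> UNIV = cspan (W \<union> B)"
    using cspan_Un_finite_iff[OF W True] by auto
  finally have 2: "(\<forall>D\<in>quotient_space W. \<exists>c. D = quotient_lincomb W c ((\<lambda>b. {b} + W) ` B))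
      \<longleftrightarrow> UNIV = cspan (W \<union> B)" .
  show ?thesis
    unfolding finite_quotient_basis_def rel_basis_def 1 2
    using W True by (auto simp: quotient_space_def)
next
  case False
  then show ?thesis
    using finite_image_iff[OF inj] rel_basisD(2) by (auto simp: finite_quotient_basis_def)
qed

lemma finite_codim_iff_fin_quot:
  assumes W: "csubspace W" shows "finite_codim W \<longleftrightarrow> fin_quot W UNIV"
proof
  assume "finite_codim W"
  then obtain C where C: "finite_quotient_basis W C" by (auto simp: finite_codim_def)
  then obtain B where "inj_on (\<lambda>b. {b} + W) B" "C = (\<lambda>b. {b} + W) ` B"
    unfolding finite_quotient_basis_def quotient_space_def subset_image_inj by auto
  then show "fin_quot W UNIV"
    using C finite_quotient_basis_cosets_iff[OF W] by (auto simp: fin_quot_def)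
next
  assume "fin_quot W UNIV"
  then show "finite_codim W"
    unfolding fin_quot_def finite_codim_def
    using rel_basis_inj_coset finite_quotient_basis_cosets_iff[OF W] by blast
qed

lemma codim_eq_qdim:
  assumes W: "csubspace W" and fin: "fin_quot W UNIV"
  shows "codim W = qdim W UNIV"
proof -
  have "card C = qdim W UNIV" if C: "finite_quotient_basis W C" for C
  proof -
    obtain B where B: "inj_on (\<lambda>b. {b} + W) B" "C = (\<lambda>b. {b} + W) ` B"
      using C unfolding finite_quotient_basis_def quotient_space_def subset_image_inj by auto
    then have "rel_basis W UNIV B"
      using C finite_quotient_basis_cosets_iff[OF W B(1)] by simp
    then show ?thesis
      using qdim_eq card_image[OF B(1)] B(2) by metis
  qed
  moreover have "finite_codim W"
    using fin finite_codim_iff_fin_quot[OF W] by simp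
  ultimately show ?thesis
    by (metis codim_def finite_codim_def someI_ex)
qed

lemma rel_basis_0_iff: "rel_basis {0} L B \<longleftrightarrow> finite B \<and> \<not> cdependent B \<and> L = cspan B"
proof -
  have "indep_mod {0} B \<longleftrightarrow> \<not> cdependent B" if "finite B"
    using complex_vector.dependent_finite[OF that] that by (auto simp: indep_mod_def)
  then show ?thesis
    by (auto simp: rel_basis_def indep_mod_def complex_vector.subspace_single_0)
qed

lemma fin_quot_0_iff: "fin_quot {0} L \<longleftrightarrow> (\<exists>B. finite B \<and> L = cspan B)"
  using fin_quotI[of "{0}"] complex_vector.subspace_single_0
  by (auto simp: fin_quot_def rel_basis_0_iff)

lemma cdim_eq_qdim:
  assumes "fin_quot {0} L" shows "cdim L = qdim {0} L"
proof -
  obtain B where B: "rel_basis {0} L B" using assms by (auto simp: fin_quot_def)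
  then have "cdim L = card B"
    by (intro complex_vector.dim_eq_card) (auto simp: rel_basis_0_iff complex_vector.span_span)
  then show ?thesis using qdim_eq[OF B] by simp
qed

lemma csubspace_ker: "T \<in> cblinops \<Longrightarrow> csubspace (ker T)"
  using csubspace_vimage[of T "{0}"] complex_vector.subspace_single_0
  by (simp add: ker_def vimage_def)

lemma csubspace_range: "T \<in> cblinops \<Longrightarrow> csubspace (range (blinfun_apply T))"
  by (rule csubspace_image) auto

lemma fredholm_iff:
  "fredholm T \<longleftrightarrow> T \<in> cblinops \<and> closed (range (blinfun_apply T)) \<and>
     fin_quot {0} (ker T) \<and> fin_quot (range (blinfun_apply T)) UNIV"
  unfolding fredholm_def fin_quot_0_iff
  using finite_codim_iff_fin_quot[OF csubspace_range] by blast

lemma ind_eq_qdim: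
  assumes "T \<in> cblinops" "fin_quot {0} (ker T)" "fin_quot (range (blinfun_apply T)) UNIV"
  shows "ind T = int (qdim {0} (ker T)) - int (qdim (range (blinfun_apply T)) UNIV)"
  using assms by (simp add: ind_def cdim_eq_qdim codim_eq_qdim csubspace_range)

section \<open>The index of a composition\<close>

lemma image_ker: "T \<in> cblinops \<Longrightarrow> blinfun_apply T ` ker T = {0}"
  by (auto simp: ker_def image_iff intro!: exI[of _ 0] blinfun.zero_right)

text \<open>Preimages of a basis of \<open>T L\<close> span \<open>L\<close> modulo the kernel.\<close>

lemma fin_quot_ker:
  assumes T: "T \<in> cblinops" and L: "csubspace L" and fin: "fin_quot {0} (blinfun_apply T ` L)"
  shows "fin_quot (ker T \<inter> L) L"
proof -
  obtain B where B: "rel_basis {0} (blinfun_apply T ` L) B" using fin by (auto simp: fin_quot_def)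
  then have "\<forall>b\<in>B. \<exists>x. x \<in> L \<and> blinfun_apply T x = b"
    using rel_basisD(5)[OF B] by blast
  then obtain f where f: "\<And>b. b \<in> B \<Longrightarrow> f b \<in> L" "\<And>b. b \<in> B \<Longrightarrow> blinfun_apply T (f b) = b"
    by metis
  have "x \<in> cspan ((ker T \<inter> L) \<union> f ` B)" if x: "x \<in> L" for x
  proof -
    have "blinfun_apply T x \<in> cspan B"
      using x B by (auto simp: rel_basis_0_iff)
    then obtain c where c: "blinfun_apply T x = (\<Sum>b\<in>B. c b *\<^sub>C b)"
      using B by (auto simp: rel_basis_0_iff complex_vector.span_finite)
    define y where "y = (\<Sum>b\<in>B. c b *\<^sub>C f b)"
    have "y \<in> L"
      unfolding y_def using f L by (intro complex_vector.subspace_sum complex_vector.subspace_scale) auto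
    moreover have "blinfun_apply T y = blinfun_apply T x"
      unfolding y_def c cblinops_sum[OF T] using f by (intro sum.cong) auto
    ultimately have "x - y \<in> ker T \<inter> L"
      using x L by (simp add: ker_def blinfun.diff_right complex_vector.subspace_diff)
    moreover have "y \<in> cspan (f ` B)"
      unfolding y_def by (intro complex_vector.span_sum complex_vector.span_scale complex_vector.span_base) auto
    ultimately have "(x - y) + y \<in> cspan ((ker T \<inter> L) \<union> f ` B)"
      by (meson complex_vector.span_add complex_vector.span_base complex_vector.span_mono UnI1 sup_ge2 subsetD)
    then show ?thesis by simp
  qed
  moreover have "cspan ((ker T \<inter> L) \<union> f ` B) \<subseteq> L"
    using f L by (intro complex_vector.span_minimal) auto
  ultimately have "L = cspan ((ker T \<inter> L) \<union> f ` B)" by blast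
  then show ?thesis
    using fin_quotI[OF complex_vector.subspace_inter[OF csubspace_ker[OF T] L], of "f ` B"] B
    by (auto simp: rel_basis_0_iff)
qed

text \<open>Put \<open>K = ker S \<inter> range T\<close> and \<open>H = range T + ker S\<close>. Then \<open>ker (S T) / ker T\<close> is isomorphic to
\<open>K\<close>, and \<open>range S / range (S T)\<close> is isomorphic to \<open>UNIV / H\<close>. In the difference of dimensions,
the remaining parts \<open>ker S / K\<close> and \<open>H / range T\<close> cancel because they are isomorphic.\<close>

lemma ind_compose:
  fixes T :: "'a::complex_normed_vector \<Rightarrow>\<^sub>L 'b::complex_normed_vector"
    and S :: "'b \<Rightarrow>\<^sub>L 'c::complex_normed_vector"
  assumes S: "fredholm S" and T: "fredholm T"
  shows "ind (S o\<^sub>L T) = ind S + ind T"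
proof -
  let ?RT = "range (blinfun_apply T)" and ?RS = "range (blinfun_apply S)"
  let ?RST = "range (blinfun_apply (S o\<^sub>L T))"
  have S': "S \<in> cblinops" "fin_quot {0} (ker S)" "fin_quot ?RS UNIV"
    and T': "T \<in> cblinops" "fin_quot {0} (ker T)" "fin_quot ?RT UNIV"
    using S T by (auto simp: fredholm_iff)
  have ST: "S o\<^sub>L T \<in> cblinops" using S' T' by simp
  note sub = csubspace_ker[OF S'(1)] csubspace_ker[OF T'(1)] csubspace_ker[OF ST]
    csubspace_range[OF S'(1)] csubspace_range[OF T'(1)] csubspace_range[OF ST]
  define K where "K = ker S \<inter> ?RT"
  have K: "csubspace K" unfolding K_def using sub by (intro complex_vector.subspace_inter)
  have "0 \<in> K" using K by (rule complex_vector.subspace_0)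
  then have K0: "fin_quot {0} K" and KS: "fin_quot K (ker S)"
    using fin_quot_between[OF S'(2) K] by (auto simp: K_def)
  \<comment> \<open>the kernel of the composition\<close>
  have TK: "blinfun_apply T ` ker (S o\<^sub>L T) = K"
    by (auto simp: K_def ker_def)
  have kerT_sub: "ker T \<subseteq> ker (S o\<^sub>L T)"
    by (auto simp: ker_def blinfun.zero_right)
  have fKT: "fin_quot (ker T) (ker (S o\<^sub>L T))"
    using fin_quot_ker[OF T'(1) sub(3)] K0 kerT_sub by (simp add: TK Int_absorb2)
  have "qdim (ker T) (ker (S o\<^sub>L T)) = qdim {0} K"
  proof -
    have "x \<in> ker T" if "blinfun_apply T x = 0" for x
      using that by (simp add: ker_def)
    from quotient_image(2)[OF T'(1) fKT this] show ?thesis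
      by (simp add: TK image_ker[OF T'(1)])
  qed
  then have ker: "fin_quot {0} (ker (S o\<^sub>L T))"
    "qdim {0} (ker (S o\<^sub>L T)) = qdim {0} (ker T) + qdim {0} K"
    using quotient_tower[OF T'(2) fKT] by auto
  \<comment> \<open>the range of the composition\<close>
  define H where "H = cspan (?RT \<union> ker S)"
  have H: "csubspace H" "?RT \<subseteq> H" "ker S \<subseteq> H" "H \<subseteq> UNIV"
    using complex_vector.span_superset[of "?RT \<union> ker S"] by (auto simp: H_def)
  have RH: "fin_quot ?RT H" "fin_quot H UNIV"
    using fin_quot_between[OF T'(3) H(1,2,4)] by auto
  have qRH: "qdim ?RT H = qdim K (ker S)"
    using quotient_sum(2)[OF sub(5), of "ker S"] KS by (simp add: H_def K_def)
  have SH: "blinfun_apply S ` H = ?RST"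
  proof -
    have "blinfun_apply S ` H = cspan (blinfun_apply S ` (?RT \<union> ker S))"
      unfolding H_def by (rule cspan_image[OF S'(1)])
    also have "blinfun_apply S ` (?RT \<union> ker S) = ?RST"
      using complex_vector.subspace_0[OF sub(6)] by (auto simp: ker_def image_iff)
    also have "cspan ?RST = ?RST"
      using sub(6) by (simp add: complex_vector.span_eq_iff)
    finally show ?thesis .
  qed
  have "fin_quot (blinfun_apply S ` H) ?RS" "qdim (blinfun_apply S ` H) ?RS = qdim H UNIV"
    using quotient_image[OF S'(1) RH(2)] H(3) by (auto simp: ker_def)
  then have "fin_quot ?RST ?RS" "qdim ?RST ?RS = qdim H UNIV"
    by (simp_all add: SH)
  then have ran: "fin_quot ?RST UNIV" "qdim ?RST UNIV = qdim H UNIV + qdim ?RS UNIV"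
    using quotient_tower[of ?RST ?RS UNIV] S'(3) by auto
  have "qdim {0} (ker S) = qdim {0} K + qdim K (ker S)"
    using quotient_tower[OF K0 KS] by simp
  moreover have "qdim ?RT UNIV = qdim K (ker S) + qdim H UNIV"
    using quotient_tower[OF RH] qRH by simp
  ultimately show ?thesis
    using ker ran ind_eq_qdim[OF S'] ind_eq_qdim[OF T'] ind_eq_qdim[OF ST ker(1) ran(1)]
    by simp
qed

section \<open>The Hahn-Banach theorem\<close>

text \<open>The two conditions entail \<open>p (t x) = t p x\<close> for \<open>t \<ge> 0\<close>; the inequality is easier to check for
infima.\<close>

definition sublinear :: "('a::real_vector \<Rightarrow> real) \<Rightarrow> bool"
  where "sublinear p \<longleftrightarrow> (\<forall>x y. p (x + y) \<le> p x + p y) \<and> (\<forall>t\<ge>0. \<forall>x. p (t *\<^sub>R x) \<le> t * p x)"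

lemma sublinearD:
  assumes "sublinear p"
  shows "p (x + y) \<le> p x + p y" "t \<ge> 0 \<Longrightarrow> p (t *\<^sub>R x) \<le> t * p x" "p 0 = 0" "- p (- x) \<le> p x"
proof -
  show 1: "p (x + y) \<le> p x + p y" for x y using assms by (simp add: sublinear_def)
  show 2: "t \<ge> 0 \<Longrightarrow> p (t *\<^sub>R x) \<le> t * p x" for t x using assms by (simp add: sublinear_def)
  show 3: "p 0 = 0" using 1[of 0 0] 2[of 0 0] by simp
  show "- p (- x) \<le> p x" using 1[of x "- x"] 3 by simp
qed

text \<open>Two infima of sublinear functionals are needed: over chains, to apply Zorn's lemma, and over the
family that appears in \<open>sublinear_shift\<close>. The conditions on \<open>F\<close> cover both.\<close>

lemma sublinearI_Inf:
  fixes F :: "('a::real_vector \<Rightarrow> real) set"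
  assumes ne: "F \<noteq> {}" and bdd: "\<And>x. bdd_below ((\<lambda>q. q x) ` F)"
    and add: "\<And>p q x y. p \<in> F \<Longrightarrow> q \<in> F \<Longrightarrow> \<exists>r\<in>F. r (x + y) \<le> p x + q y"
    and scale: "\<And>p t x. p \<in> F \<Longrightarrow> t > 0 \<Longrightarrow> \<exists>r\<in>F. r (t *\<^sub>R x) \<le> t * p x"
    and zero: "\<exists>p\<in>F. p 0 \<le> 0"
  shows "sublinear (\<lambda>x. INF q\<in>F. q x)"
  unfolding sublinear_def
proof (intro conjI allI impI)
  fix x y
  have le: "(INF q\<in>F. q (x + y)) \<le> p x + q y" if "p \<in> F" "q \<in> F" for p q
    using add[OF that, of x y] cINF_lower[OF bdd] by (meson order_trans)
  have "(INF q\<in>F. q (x + y)) - p x \<le> (INF q\<in>F. q y)" if "p \<in> F" for p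
    using le[OF that] by (intro cINF_greatest[OF ne]) (simp add: algebra_simps)
  then have "(INF q\<in>F. q (x + y)) - (INF q\<in>F. q y) \<le> p x" if "p \<in> F" for p
    using that by (simp add: algebra_simps)
  then have "(INF q\<in>F. q (x + y)) - (INF q\<in>F. q y) \<le> (INF q\<in>F. q x)"
    by (intro cINF_greatest[OF ne])
  then show "(INF q\<in>F. q (x + y)) \<le> (INF q\<in>F. q x) + (INF q\<in>F. q y)"
    by simp
next
  fix t :: real and x assume "t \<ge> 0"
  show "(INF q\<in>F. q (t *\<^sub>R x)) \<le> t * (INF q\<in>F. q x)"
  proof (cases "t = 0")
    case True
    then show ?thesis using zero cINF_lower[OF bdd, of _ 0] by (auto intro: order_trans)
  next
    case False
    with \<open>t \<ge> 0\<close> have t: "t > 0" by simp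
    have "(INF q\<in>F. q (t *\<^sub>R x)) \<le> t * p x" if "p \<in> F" for p
      using scale[OF that t, of x] cINF_lower[OF bdd] by (meson order_trans)
    then have "(INF q\<in>F. q (t *\<^sub>R x)) / t \<le> (INF q\<in>F. q x)"
      using t by (intro cINF_greatest[OF ne]) (simp add: field_simps)
    then show ?thesis using t by (simp add: field_simps)
  qed
qed

text \<open>The witness is \<open>r x = inf {q (x + t y) - t q y | t \<ge> 0}\<close>: taking \<open>t = 0\<close> shows \<open>r \<le> q\<close> and taking
\<open>t = 1\<close> at \<open>- y\<close> gives the bound. For a minimal \<open>q\<close> this forces \<open>q (- y) = - q y\<close>, and for an
arbitrary one it prepares a functional all of whose linear minorants attain the value \<open>q y\<close> at \<open>y\<close>.\<close>

lemma sublinear_shift: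
  assumes q: "sublinear q"
  shows "\<exists>r. sublinear r \<and> r \<le> q \<and> r (- y) \<le> - q y"
proof -
  \<comment> \<open>the functionals \<open>x \<mapsto> q (x + t y) - t q y\<close>, bounded below by \<open>- q (- x)\<close> at \<open>x\<close>\<close>
  define F where "F = (\<lambda>t x. q (x + t *\<^sub>R y) - t * q y) ` {0..}"
  let ?r = "\<lambda>x. INF f\<in>F. f x"
  have bdd: "bdd_below ((\<lambda>f. f x) ` F)" for x
  proof (rule bdd_belowI)
    fix z assume "z \<in> (\<lambda>f. f x) ` F"
    then obtain t where t: "t \<ge> 0" "z = q (x + t *\<^sub>R y) - t * q y" by (auto simp: F_def)
    have "q (t *\<^sub>R y) \<le> q (- x) + q (x + t *\<^sub>R y)"
      using sublinearD(1)[OF q, of "- x" "x + t *\<^sub>R y"] by simp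
    moreover have "t * q y \<le> q (t *\<^sub>R y)"
    proof (cases "t = 0")
      case False
      then have "q y \<le> inverse t * q (t *\<^sub>R y)"
        using sublinearD(2)[OF q, of "inverse t" "t *\<^sub>R y"] t by simp
      then show ?thesis using False t by (simp add: field_simps)
    qed (use sublinearD(3)[OF q] in simp)
    ultimately show "- q (- x) \<le> z" using t by simp
  qed
  have "sublinear ?r"
  proof (rule sublinearI_Inf[OF _ bdd])
    show "F \<noteq> {}" by (auto simp: F_def)
    show "\<exists>p\<in>F. p 0 \<le> 0" using sublinearD(3)[OF q] by (auto simp: F_def intro!: bexI[of _ 0])
  next
    fix f g x z assume "f \<in> F" "g \<in> F"
    then obtain s t where st: "s \<ge> 0" "t \<ge> 0" "f = (\<lambda>x. q (x + s *\<^sub>R y) - s * q y)" "g = (\<lambda>x. q (x + t *\<^sub>R y) - t * q y)"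
      by (auto simp: F_def)
    show "\<exists>r\<in>F. r (x + z) \<le> f x + g z"
    proof
      show "(\<lambda>x. q (x + (s + t) *\<^sub>R y) - (s + t) * q y) \<in> F" using st by (auto simp: F_def)
      have "q ((x + z) + (s + t) *\<^sub>R y) \<le> q (x + s *\<^sub>R y) + q (z + t *\<^sub>R y)"
        using sublinearD(1)[OF q, of "x + s *\<^sub>R y" "z + t *\<^sub>R y"] by (simp add: algebra_simps)
      then show "q ((x + z) + (s + t) *\<^sub>R y) - (s + t) * q y \<le> f x + g z"
        by (simp add: st algebra_simps)
    qed
  next
    fix f x and s :: real assume "f \<in> F" and s: "s > 0"
    then obtain t where t: "t \<ge> 0" "f = (\<lambda>x. q (x + t *\<^sub>R y) - t * q y)"
      by (auto simp: F_def)
    show "\<exists>r\<in>F. r (s *\<^sub>R x) \<le> s * f x"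
    proof
      show "(\<lambda>x. q (x + (s * t) *\<^sub>R y) - (s * t) * q y) \<in> F" using s t by (auto simp: F_def)
      have "q (s *\<^sub>R x + (s * t) *\<^sub>R y) \<le> s * q (x + t *\<^sub>R y)"
        using sublinearD(2)[OF q, of s "x + t *\<^sub>R y"] s by (simp add: algebra_simps)
      then show "q (s *\<^sub>R x + (s * t) *\<^sub>R y) - (s * t) * q y \<le> s * f x"
        by (simp add: t algebra_simps)
    qed
  qed
  moreover have "?r \<le> q"
  proof (rule le_funI)
    fix x
    have "q \<in> F" unfolding F_def by (rule image_eqI[of _ _ 0]) auto
    then show "?r x \<le> q x" by (rule cINF_lower[OF bdd])
  qed
  moreover have "?r (- y) \<le> - q y"
  proof -
    have "(\<lambda>x. q (x + 1 *\<^sub>R y) - 1 * q y) \<in> F" unfolding F_def by (rule image_eqI[of _ _ 1]) auto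
    from cINF_lower[OF bdd this, of "- y"] show ?thesis
      using sublinearD(3)[OF q] by simp
  qed
  ultimately show ?thesis by blast
qed

lemma minimal_sublinear_exists:
  assumes p: "sublinear p"
  shows "\<exists>q. sublinear q \<and> q \<le> p \<and> (\<forall>r. sublinear r \<longrightarrow> r \<le> q \<longrightarrow> r = q)"
proof -
  define A where "A = {q. sublinear q \<and> q \<le> p}"
  have "\<exists>m\<in>A. \<forall>a\<in>A. a \<le> m \<longrightarrow> a = m"
  proof (rule predicate_Zorn)
    show "partial_order_on A (relation_of (\<lambda>a b. b \<le> a) A)"
      by (rule partial_order_on_relation_ofI) auto
  next
    fix C assume C: "C \<in> Chains (relation_of (\<lambda>a b. b \<le> a) A)"
    then have CA: "C \<subseteq> A" and tot: "\<And>a b. a \<in> C \<Longrightarrow> b \<in> C \<Longrightarrow> a \<le> b \<or> b \<le> a"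
      by (auto simp: Chains_def relation_of_def)
    show "\<exists>u\<in>A. \<forall>a\<in>C. u \<le> a"
    proof (cases "C = {}")
      case True
      then show ?thesis using p by (auto simp: A_def)
    next
      case False
      let ?u = "\<lambda>x. INF q\<in>C. q x"
      have bdd: "bdd_below ((\<lambda>q. q x) ` C)" for x
      proof (rule bdd_belowI)
        fix z assume "z \<in> (\<lambda>q. q x) ` C"
        then obtain q where "q \<in> C" "z = q x" by blast
        then have "sublinear q" "q (- x) \<le> p (- x)" using CA by (auto simp: A_def le_fun_def)
        then show "- p (- x) \<le> z"
          using sublinearD(4)[of q x] \<open>z = q x\<close> by simp
      qed
      have sub: "sublinear q" if "q \<in> C" for q using that CA by (auto simp: A_def)
      have "sublinear ?u"
      proof (rule sublinearI_Inf[OF False bdd])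
        show "\<exists>q\<in>C. q 0 \<le> 0" using False sublinearD(3)[OF sub] by force
      next
        fix f g x y assume fg: "f \<in> C" "g \<in> C"
        show "\<exists>r\<in>C. r (x + y) \<le> f x + g y"
        proof (cases "f \<le> g")
          case True
          then have "f (x + y) \<le> f x + g y"
            using sublinearD(1)[OF sub[OF fg(1)], of x y] le_funD[OF True, of y] by simp
          then show ?thesis using fg by blast
        next
          case False
          then have "g \<le> f" using tot fg by blast
          then have "g (x + y) \<le> f x + g y"
            using sublinearD(1)[OF sub[OF fg(2)], of x y] le_funD[of g f x] by simp
          then show ?thesis using fg by blast
        qed
      next
        fix f x and t :: real assume f: "f \<in> C" "t > 0"
        then show "\<exists>r\<in>C. r (t *\<^sub>R x) \<le> t * f x"
          using sublinearD(2)[OF sub[OF f(1)], of t x] by (intro bexI[of _ f]) auto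
      qed
      moreover have le: "?u \<le> q" if "q \<in> C" for q
        using cINF_lower[OF bdd that] by (simp add: le_fun_def)
      moreover have "?u \<le> p"
      proof -
        obtain q where "q \<in> C" using False by blast
        then have "q \<le> p" using CA by (auto simp: A_def)
        with le[OF \<open>q \<in> C\<close>] show ?thesis by (rule order_trans)
      qed
      ultimately show ?thesis unfolding A_def by blast
    qed
  qed
  then obtain m where m: "m \<in> A" "\<And>a. a \<in> A \<Longrightarrow> a \<le> m \<Longrightarrow> a = m" by blast
  have "r = m" if "sublinear r" "r \<le> m" for r
    using m(1) that order_trans[OF that(2), of p] by (intro m(2)) (simp_all add: A_def)
  with m(1) show ?thesis by (auto simp: A_def)
qed

text \<open>An odd sublinear functional is linear, since the inequalities at \<open>x\<close> and \<open>- x\<close> are opposite to each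
other.\<close>

lemma minimal_sublinear_linear:
  assumes q: "sublinear q" and min: "\<And>r. sublinear r \<Longrightarrow> r \<le> q \<Longrightarrow> r = q"
  shows "linear q"
proof -
  have "q (- y) \<le> - q y" for y
    using sublinear_shift[OF q, of y] min by blast
  then have neg: "q (- y) = - q y" for y
    using sublinearD(4)[OF q, of y] by (smt (verit))
  show ?thesis
  proof (rule linearI)
    fix x y show "q (x + y) = q x + q y"
      using sublinearD(1)[OF q, of x y] sublinearD(1)[OF q, of "- x" "- y"] neg[of "x + y"] neg[of x] neg[of y]
      by simp
  next
    fix t x
    have pos: "q (t *\<^sub>R x) = t * q x" if "t \<ge> 0" for t x
      using sublinearD(2)[OF q that, of x] sublinearD(2)[OF q that, of "- x"] neg[of x] neg[of "t *\<^sub>R x"]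
      by simp
    show "q (t *\<^sub>R x) = t *\<^sub>R q x"
    proof (cases "t \<ge> 0")
      case False
      then show ?thesis using pos[of "- t" x] neg[of "t *\<^sub>R x"] by simp
    qed (use pos in simp)
  qed
qed

text \<open>A minimal sublinear functional below \<open>p\<close> is linear. This form of the Hahn-Banach theorem deals only with
functionals on the whole space, so that partially defined linear maps do not occur.\<close>

lemma hahn_banach_sublinear:
  assumes p: "sublinear p"
  shows "\<exists>g. linear g \<and> g \<le> p \<and> g b = p b"
proof -
  obtain r where r: "sublinear r" "r \<le> p" "r (- b) \<le> - p b" using sublinear_shift[OF p] by blast
  obtain g where g: "sublinear g" "g \<le> r" "\<And>h. sublinear h \<Longrightarrow> h \<le> g \<Longrightarrow> h = g"
    using minimal_sublinear_exists[OF r(1)] by blast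
  have lin: "linear g" using minimal_sublinear_linear[OF g(1,3)] .
  have "g (- b) \<le> - p b" using le_funD[OF g(2), of "- b"] r(3) by simp
  then have "p b \<le> g b" using linear_neg[OF lin] by simp
  moreover have "g \<le> p" using g r by simp
  ultimately show ?thesis using lin le_funD[of g p b] by force
qed

text \<open>The distance from \<open>R\<close> is the seminorm of the quotient by \<open>R\<close>. Linear functionals below
it vanish on \<open>R\<close> and are bounded.\<close>

lemma sublinear_infdist:
  fixes R :: "'a::complex_normed_vector set"
  assumes R: "csubspace R"
  shows "sublinear (\<lambda>x. infdist x R)"
proof -
  have ne: "R \<noteq> {}" using complex_vector.subspace_0[OF R] by blast
  have approx: "\<exists>a\<in>R. norm (x - a) < infdist x R + e" if "e > 0" for x and e :: real
  proof -
    have "(INF a\<in>R. dist x a) < infdist x R + e"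
      using that by (simp add: infdist_notempty[OF ne])
    then show ?thesis
      by (subst (asm) cINF_less_iff[OF ne]) (auto simp: dist_norm intro: bdd_belowI[of _ 0])
  qed
  have le: "infdist x R \<le> norm (x - a)" if "a \<in> R" for x a
    using infdist_le[OF that] by (simp add: dist_norm)
  show ?thesis unfolding sublinear_def
  proof (intro conjI allI impI)
    fix x y
    show "infdist (x + y) R \<le> infdist x R + infdist y R"
    proof (rule field_le_epsilon)
      fix e :: real assume "e > 0"
      then obtain a c where ac: "a \<in> R" "c \<in> R" "norm (x - a) < infdist x R + e / 2" "norm (y - c) < infdist y R + e / 2"
        using approx[of "e / 2"] by (meson half_gt_zero)
      have "infdist (x + y) R \<le> norm ((x - a) + (y - c))"
        using le[OF complex_vector.subspace_add[OF R ac(1,2)], of "x + y"] by (simp add: algebra_simps)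
      then show "infdist (x + y) R \<le> infdist x R + infdist y R + e"
        using norm_triangle_ineq[of "x - a" "y - c"] ac by simp
    qed
  next
    fix t :: real and x assume "t \<ge> 0"
    show "infdist (t *\<^sub>R x) R \<le> t * infdist x R"
    proof (cases "t = 0")
      case True
      then show ?thesis using complex_vector.subspace_0[OF R] by simp
    next
      case False
      with \<open>t \<ge> 0\<close> have t: "t > 0" by simp
      show ?thesis
      proof (rule field_le_epsilon)
        fix e :: real assume "e > 0"
        with t have "e / t > 0" by simp
        then obtain a where a: "a \<in> R" "norm (x - a) < infdist x R + e / t" using approx by blast
        have "t *\<^sub>R a \<in> R" using a(1) complex_vector.subspace_scale[OF R] by (simp add: scaleR_scaleC)
        then have "infdist (t *\<^sub>R x) R \<le> norm (t *\<^sub>R (x - a))"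
          using le[of "t *\<^sub>R a" "t *\<^sub>R x"] by (simp add: algebra_simps)
        also have "\<dots> = t * norm (x - a)" using t by simp
        also have "\<dots> \<le> t * (infdist x R + e / t)" using a t by simp
        also have "\<dots> = t * infdist x R + e" using t by (simp add: field_simps)
        finally show "infdist (t *\<^sub>R x) R \<le> t * infdist x R + e" .
      qed
    qed
  qed
qed

definition clinear_functional :: "('a::complex_normed_vector \<Rightarrow> complex) \<Rightarrow> bool"
  where "clinear_functional f \<longleftrightarrow> bounded_linear f \<and> (\<forall>c x. f (c *\<^sub>C x) = c * f x)"

text \<open>A real functional \<open>g\<close> that is dominated by the distance from \<open>R\<close> and equal to it at \<open>b\<close> is the real
part of the complex functional \<open>f x = g x - \<i> g (\<i> x)\<close>. Dividing by \<open>f b\<close> normalises the latter.\<close>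

lemma clinear_functional_separation:
  fixes R :: "'a::complex_normed_vector set"
  assumes R: "csubspace R" "closed R" and b: "b \<notin> R"
  shows "\<exists>f. clinear_functional f \<and> (\<forall>x\<in>R. f x = 0) \<and> f b = 1"
proof -
  obtain g where g: "linear g" "g \<le> (\<lambda>x. infdist x R)" "g b = infdist b R"
    using hahn_banach_sublinear[OF sublinear_infdist[OF R(1)]] by blast
  have R0: "0 \<in> R" by (rule complex_vector.subspace_0[OF R(1)])
  have gb: "g b > 0" using g(3) infdist_pos_not_in_closed[OF R(2) _ b] R0 by auto
  have gle: "g x \<le> infdist x R" for x using le_funD[OF g(2)] .
  have gneg: "g (- x) = - g x" for x using linear_neg[OF g(1)] .
  have gR: "g x = 0" if "x \<in> R" for x
    using gle[of x] gle[of "- x"] that complex_vector.subspace_neg[OF R(1) that] gneg[of x] by simp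
  have gnorm: "\<bar>g x\<bar> \<le> norm x" for x
    using gle[of x] gle[of "- x"] gneg[of x] infdist_le[OF R0, of x] infdist_le[OF R0, of "- x"] by simp
  define f where "f x = complex_of_real (g x) - \<i> * complex_of_real (g (\<i> *\<^sub>C x))" for x
  have fadd: "f (x + y) = f x + f y" for x y
    by (simp add: f_def linear_add[OF g(1)] scaleC_add_right algebra_simps)
  have fR: "f (r *\<^sub>R x) = r * f x" for r x
  proof -
    have "\<i> *\<^sub>C r *\<^sub>R x = r *\<^sub>R \<i> *\<^sub>C x"
      by (simp add: scaleR_scaleC scaleC_scaleC mult.commute)
    then show ?thesis
      by (simp add: f_def linear_scale[OF g(1)] algebra_simps)
  qed
  have fi: "f (\<i> *\<^sub>C x) = \<i> * f x" for x
  proof -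
    have "\<i> *\<^sub>C \<i> *\<^sub>C x = - x"
      using scaleR_scaleC[of "-1" x] by (simp add: scaleC_scaleC)
    then show ?thesis
      by (simp add: f_def gneg algebra_simps)
  qed
  have fC: "f (c *\<^sub>C x) = c * f x" for c x
  proof -
    have "c *\<^sub>C x = Re c *\<^sub>R x + \<i> *\<^sub>C (Im c *\<^sub>R x)"
      by (simp add: scaleR_scaleC scaleC_scaleC flip: scaleC_add_left complex_eq)
    then have "f (c *\<^sub>C x) = (Re c + \<i> * Im c) * f x"
      by (simp add: fadd fR fi algebra_simps)
    then show ?thesis by (simp flip: complex_eq)
  qed
  have "bounded_linear f"
  proof (rule bounded_linear_intro)
    show "f (x + y) = f x + f y" for x y by (rule fadd)
    show "f (r *\<^sub>R x) = r *\<^sub>R f x" for r x by (simp add: fR scaleR_conv_of_real)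
    fix x
    have "cmod (f x) \<le> cmod (complex_of_real (g x)) + cmod (\<i> * complex_of_real (g (\<i> *\<^sub>C x)))"
      unfolding f_def by (rule norm_triangle_ineq4)
    also have "\<dots> \<le> norm x + norm (\<i> *\<^sub>C x)"
      using gnorm[of x] gnorm[of "\<i> *\<^sub>C x"] by (simp add: norm_mult)
    finally show "cmod (f x) \<le> norm x * 2" by (simp add: norm_scaleC)
  qed
  have "Re (f b) = g b" by (simp add: f_def)
  then have fb: "f b \<noteq> 0" using gb by auto
  have "bounded_linear (\<lambda>x. inverse (f b) * f x)"
    using \<open>bounded_linear f\<close> by (rule bounded_linear_const_mult)
  moreover have "f x = 0" if "x \<in> R" for x
    using gR[OF that] gR[OF complex_vector.subspace_scale[OF R(1) that]] by (simp add: f_def)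
  ultimately show ?thesis
    using fb by (intro exI[of _ "\<lambda>x. inverse (f b) * f x"]) (auto simp: clinear_functional_def fC)
qed

section \<open>Projections of finite rank\<close>

lemma bounded_linear_rank_one:
  assumes "clinear_functional f"
  shows "bounded_linear (\<lambda>x. f x *\<^sub>C b)"
proof -
  have f: "bounded_linear f" "\<And>c x. f (c *\<^sub>C x) = c * f x"
    using assms by (auto simp: clinear_functional_def)
  obtain K where K: "\<And>x. cmod (f x) \<le> norm x * K"
    using bounded_linear.bounded[OF f(1)] by blast
  show ?thesis
  proof (rule bounded_linear_intro)
    show "f (x + y) *\<^sub>C b = f x *\<^sub>C b + f y *\<^sub>C b" for x y
      by (simp add: linear_add[OF bounded_linear.linear[OF f(1)]] scaleC_add_left)
    show "f (r *\<^sub>R x) *\<^sub>C b = r *\<^sub>R f x *\<^sub>C b" for r x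
      by (simp add: scaleR_scaleC scaleC_scaleC f(2))
    show "norm (f x *\<^sub>C b) \<le> norm x * (K * norm b)" for x
      using mult_right_mono[OF K[of x], of "norm b"] by (simp add: norm_scaleC mult.assoc)
  qed
qed

text \<open>With a functional \<open>f\<close> that vanishes on a closed subspace \<open>L\<close> and has the value 1 at \<open>x\<close>, the span of \<open>L\<close>
and \<open>x\<close> is the preimage of \<open>L\<close> under the continuous map \<open>y \<mapsto> y - f y x\<close>, and hence closed.\<close>

lemma closed_cspan_Un:
  fixes R :: "'a::complex_normed_vector set"
  assumes R: "csubspace R" "closed R" and B: "finite B"
  shows "closed (cspan (R \<union> B))"
  using B
proof (induction B)
  case empty
  then show ?case using R by (simp add: complex_vector.span_eq_iff[THEN iffD2])
next
  case (insert x B)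
  let ?L = "cspan (R \<union> B)"
  have eq: "cspan (insert x ?L) = cspan (R \<union> insert x B)"
    using cspan_cspan_Un[of "R \<union> B" "{x}"] by simp
  show ?case
  proof (cases "x \<in> ?L")
    case True
    then show ?thesis
      using insert.IH eq complex_vector.span_redundant[OF True] by (simp add: insert_absorb complex_vector.span_span)
  next
    case False
    then obtain f where f: "clinear_functional f" "\<And>y. y \<in> ?L \<Longrightarrow> f y = 0" "f x = 1"
      using clinear_functional_separation[OF complex_vector.subspace_span insert.IH False] by blast
    have lin: "f (y - k *\<^sub>C x) = f y - k" for y k
      using f by (simp add: clinear_functional_def linear_diff bounded_linear.linear)
    have "cspan (insert x ?L) = {y. y - f y *\<^sub>C x \<in> ?L}"
    proof -
      have "y \<in> cspan (insert x ?L) \<longleftrightarrow> y - f y *\<^sub>C x \<in> ?L" for y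
      proof -
        have "k = f y" if "y - k *\<^sub>C x \<in> ?L" for k
          using f(2)[OF that] lin[of y k] by simp
        then show ?thesis
          by (auto simp: complex_vector.span_breakdown_eq complex_vector.span_span)
      qed
      then show ?thesis by blast
    qed
    moreover have "closed ((\<lambda>y. y - f y *\<^sub>C x) -` ?L)"
      using bounded_linear_rank_one[OF f(1)]
      by (intro closed_vimage insert.IH continuous_intros linear_continuous_on bounded_linear_ident)
    ultimately show ?thesis using eq by (simp add: vimage_def)
  qed
qed

definition finite_rank :: "('a::complex_normed_vector \<Rightarrow>\<^sub>L 'b::complex_normed_vector) \<Rightarrow> bool"
  where "finite_rank F \<longleftrightarrow> F \<in> cblinops \<and> fin_quot {0} (range (blinfun_apply F))"

lemma finite_rankI:
  assumes F: "F \<in> cblinops" and L: "fin_quot {0} L" "range (blinfun_apply F) \<subseteq> L"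
  shows "finite_rank F"
  unfolding finite_rank_def
proof
  have sub: "csubspace (range (blinfun_apply F))" using F by (intro csubspace_image) auto
  show "fin_quot {0} (range (blinfun_apply F))"
    using complex_vector.subspace_0[OF sub] by (intro fin_quot_between(1)[OF L(1) sub _ L(2)]) simp
qed (rule F)

text \<open>The projection is built from functionals that are dual to a basis of \<open>L / R\<close>. It will be used with
\<open>R = {0}\<close> to project onto the kernel of a Fredholm operator, and with \<open>L = UNIV\<close> to project along its
range.\<close>

lemma finite_rank_projection:
  fixes R :: "'a::complex_normed_vector set"
  assumes R: "closed R" "fin_quot R L"
  shows "\<exists>Q. finite_rank Q \<and> range (blinfun_apply Q) \<subseteq> L \<and> (\<forall>x\<in>R. blinfun_apply Q x = 0) \<and>
           (\<forall>x\<in>L. x - blinfun_apply Q x \<in> R)"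
proof -
  obtain B where B: "rel_basis R L B" using R(2) by (auto simp: fin_quot_def)
  note BD = rel_basisD[OF B]
  have "\<exists>f. clinear_functional f \<and> (\<forall>x\<in>R. f x = 0) \<and> (\<forall>b'\<in>B. f b' = (if b' = b then 1 else 0))"
    if b: "b \<in> B" for b
  proof -
    let ?H = "cspan (R \<union> (B - {b}))"
    \<comment> \<open>otherwise \<open>b\<close> would depend on the rest of \<open>B\<close> modulo \<open>R\<close>\<close>
    have "b \<notin> ?H"
    proof
      assume "b \<in> ?H"
      then obtain c where c: "b - (\<Sum>x\<in>B - {b}. c x *\<^sub>C x) \<in> R"
        using cspan_Un_finite_iff[OF BD(1), of "B - {b}"] BD(2) by auto
      define d where "d = (\<lambda>x. if x = b then 1 else - c x)"
      have "(\<Sum>x\<in>B. d x *\<^sub>C x) = b + (\<Sum>x\<in>B - {b}. d x *\<^sub>C x)"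
        using b BD(2) by (subst sum.remove[of B b]) (auto simp: d_def)
      also have "(\<Sum>x\<in>B - {b}. d x *\<^sub>C x) = - (\<Sum>x\<in>B - {b}. c x *\<^sub>C x)"
        unfolding sum_negf[symmetric]
        by (rule sum.cong) (auto simp: d_def)
      finally have "(\<Sum>x\<in>B. d x *\<^sub>C x) \<in> R" using c by simp
      then have "d b = 0" using B b by (auto simp: rel_basis_def indep_mod_def)
      then show False by (simp add: d_def)
    qed
    then obtain f where f: "clinear_functional f" "\<And>x. x \<in> ?H \<Longrightarrow> f x = 0" "f b = 1"
      using clinear_functional_separation[OF complex_vector.subspace_span closed_cspan_Un[OF BD(1) R(1)], of "B - {b}" b] BD(2)
      by blast
    have "x \<in> ?H" if "x \<in> R \<or> x \<in> B \<and> x \<noteq> b" for x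
      using that by (intro complex_vector.span_base) auto
    then show ?thesis using f by auto
  qed
  then obtain f where f: "\<And>b. b \<in> B \<Longrightarrow> clinear_functional (f b)"
    "\<And>b x. b \<in> B \<Longrightarrow> x \<in> R \<Longrightarrow> f b x = 0"
    "\<And>b b'. b \<in> B \<Longrightarrow> b' \<in> B \<Longrightarrow> f b b' = (if b' = b then 1 else 0)"
    by metis
  define Q where "Q = Blinfun (\<lambda>x. \<Sum>b\<in>B. f b x *\<^sub>C b)"
  have "bounded_linear (\<lambda>x. \<Sum>b\<in>B. f b x *\<^sub>C b)"
    by (intro bounded_linear_sum bounded_linear_rank_one f)
  then have Q: "blinfun_apply Q x = (\<Sum>b\<in>B. f b x *\<^sub>C b)" for x
    by (simp add: Q_def bounded_linear_Blinfun_apply)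
  have QC: "Q \<in> cblinops"
    using f(1) by (auto simp: cblinops_def Q clinear_functional_def complex_vector.scale_sum_right scaleC_scaleC intro!: sum.cong)
  have QB: "range (blinfun_apply Q) \<subseteq> cspan B"
    using csum_in_cspan by (auto simp: Q)
  have "fin_quot {0} (cspan B)"
    using BD(2) by (intro fin_quotI[of "{0}" B] complex_vector.subspace_single_0) auto
  then have "finite_rank Q"
    using finite_rankI[OF QC _ QB] by simp
  moreover have "range (blinfun_apply Q) \<subseteq> L"
    using QB complex_vector.span_minimal[OF BD(5,3)] by blast
  moreover have QR: "\<forall>x\<in>R. blinfun_apply Q x = 0"
    using f(2) by (simp add: Q)
  moreover have "\<forall>x\<in>L. x - blinfun_apply Q x \<in> R"
  proof
    fix x assume "x \<in> L"
    then obtain c where c: "x - (\<Sum>b\<in>B. c b *\<^sub>C b) \<in> R"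
      using B cspan_Un_finite_iff[OF BD(1,2)] by (auto simp: rel_basis_def)
    have Qb: "blinfun_apply Q b = b" if "b \<in> B" for b
    proof -
      have "blinfun_apply Q b = (\<Sum>b'\<in>B. if b' = b then b' else 0)"
        unfolding Q using f(3) that by (intro sum.cong) auto
      then show ?thesis using that BD(2) by simp
    qed
    have "blinfun_apply Q (\<Sum>b\<in>B. c b *\<^sub>C b) = (\<Sum>b\<in>B. c b *\<^sub>C b)"
      using cblinops_sum[OF QC, of c "\<lambda>b. b" B] Qb by (simp cong: sum.cong)
    moreover have "blinfun_apply Q (x - (\<Sum>b\<in>B. c b *\<^sub>C b)) = 0"
      using QR c by blast
    ultimately have "blinfun_apply Q x = (\<Sum>b\<in>B. c b *\<^sub>C b)"
      by (simp add: blinfun.diff_right)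
    then show "x - blinfun_apply Q x \<in> R" using c by simp
  qed
  ultimately show ?thesis by blast
qed

section \<open>Operators with closed range\<close>

text \<open>The open mapping theorem. By Baire's theorem, applied to the complete space \<open>range T\<close>, the closure of the
image of some ball has an interior point in that space. By translation and scaling, each \<open>y\<close> in the range is
approximated up to \<open>norm y / 2\<close> by the image of an element of norm at most \<open>C * norm y\<close>. Iterating
this with the remaining error yields a convergent series that solves the equation exactly.\<close>

lemma open_mapping_bound:
  fixes T :: "'a::banach \<Rightarrow>\<^sub>L 'b::banach"
  assumes closed: "closed (range (blinfun_apply T))"
  shows "\<exists>K. \<forall>y\<in>range (blinfun_apply T). \<exists>x. blinfun_apply T x = y \<and> norm x \<le> K * norm y"
proof -
  let ?R = "range (blinfun_apply T)"
  let ?C = "\<lambda>n::nat. closure (blinfun_apply T ` cball 0 (real n))"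
  have diffR: "a - b \<in> ?R" if "a \<in> ?R" "b \<in> ?R" for a b
    using that by (auto simp flip: blinfun.diff_right)
  have scaleR: "r *\<^sub>R a \<in> ?R" if "a \<in> ?R" for a and r :: real
    using that by (auto simp flip: blinfun.scaleR_right)
  have CR: "?C n \<subseteq> ?R" for n
    using closed by (intro closure_minimal) auto
  have "\<Union>(range ?C) = ?R"
  proof
    show "\<Union>(range ?C) \<subseteq> ?R" using CR by blast
    show "?R \<subseteq> \<Union>(range ?C)"
    proof
      fix y assume "y \<in> ?R"
      then obtain x where x: "y = blinfun_apply T x" by blast
      obtain n :: nat where "norm x \<le> n" using real_arch_simple by blast
      then have "y \<in> ?C n" using x by (intro closure_subset[THEN subsetD]) auto
      then show "y \<in> \<Union>(range ?C)" by blast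
    qed
  qed
  then have "top_of_set ?R interior_of \<Union>(range ?C) = ?R"
    using interior_of_topspace[of "top_of_set ?R"] by simp
  moreover have "completely_metrizable_space (top_of_set ?R)"
    using closed completely_metrizable_space_closedin[OF completely_metrizable_space_euclidean] by auto
  moreover have "closedin (top_of_set ?R) (?C n)" for n
    using CR by (intro closed_subset) auto
  ultimately obtain n where n: "top_of_set ?R interior_of ?C n \<noteq> {}"
    using Baire_category_alt[of "top_of_set ?R" "range ?C"] by force
  then obtain y0 where y0: "y0 \<in> top_of_set ?R interior_of ?C n" by blast
  have "openin (top_of_set ?R) (top_of_set ?R interior_of ?C n)" by simp
  then obtain e where e: "e > 0" "ball y0 e \<inter> ?R \<subseteq> top_of_set ?R interior_of ?C n"
    using y0 unfolding openin_contains_ball by blast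
  have ball: "ball y0 e \<inter> ?R \<subseteq> ?C n"
    by (rule order_trans[OF e(2) interior_of_subset])
  have y0C: "y0 \<in> ?C n" by (rule subsetD[OF interior_of_subset y0])
  then have y0R: "y0 \<in> ?R" using CR by blast
  \<comment> \<open>Differences of points near \<open>y0\<close> fill a neighbourhood of 0, at the cost of doubling the radius.\<close>
  have near: "\<exists>x. norm x \<le> 2 * n \<and> norm (y - blinfun_apply T x) < d"
    if y: "y \<in> ?R" "norm y < e" and d: "d > 0" for y d
  proof -
    have "y0 + y \<in> ?R" using y0R y(1) by (auto simp flip: blinfun.add_right)
    moreover have "y0 + y \<in> ball y0 e" using y by (simp add: dist_norm)
    ultimately have "y0 + y \<in> ?C n" using ball by blast
    then obtain a where a: "norm a \<le> n" "norm (blinfun_apply T a - (y0 + y)) < d / 2"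
      using d by (auto simp: closure_approachable dist_norm dest!: spec[of _ "d / 2"])
    obtain b where b: "norm b \<le> n" "norm (blinfun_apply T b - y0) < d / 2"
      using d y0C by (auto simp: closure_approachable dist_norm dest!: spec[of _ "d / 2"])
    have "norm (a - b) \<le> 2 * n" using norm_triangle_ineq4[of a b] a b by simp
    moreover have "norm (y - blinfun_apply T (a - b)) < d"
      using norm_triangle_ineq4[of "blinfun_apply T b - y0" "blinfun_apply T a - (y0 + y)"] a b
      by (simp add: blinfun.diff_right algebra_simps)
    ultimately show ?thesis by blast
  qed
  \<comment> \<open>A vector \<open>y\<close> is scaled to norm \<open>e / 2\<close> and approximated up to \<open>e / 4\<close>; scaling back by
    \<open>2 * norm y / e\<close> turns the radius \<open>2 * n\<close> into \<open>C * norm y\<close>.\<close>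
  define C where "C = 4 * n / e"
  have C: "C \<ge> 0" using e by (simp add: C_def)
  have "\<exists>x. norm x \<le> C * norm y \<and> norm (y - blinfun_apply T x) \<le> norm y / 2" if y: "y \<in> ?R" for y
  proof (cases "y = 0")
    case True
    then show ?thesis by (intro exI[of _ 0]) (simp add: blinfun.zero_right)
  next
    case False
    define r where "r = 2 * norm y / e"
    have r: "r > 0" using False e by (simp add: r_def)
    have "norm (inverse r *\<^sub>R y) < e"
      using False e by (simp add: r_def)
    then obtain x where x: "norm x \<le> 2 * n" "norm (inverse r *\<^sub>R y - blinfun_apply T x) < e / 4"
      using near[OF scaleR[OF y]] e by (metis divide_pos_pos zero_less_numeral)
    have "norm (r *\<^sub>R x) \<le> r * (2 * n)" using x(1) r by simp
    also have "\<dots> = C * norm y" by (simp add: C_def r_def)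
    finally have 1: "norm (r *\<^sub>R x) \<le> C * norm y" .
    have "y - blinfun_apply T (r *\<^sub>R x) = r *\<^sub>R (inverse r *\<^sub>R y - blinfun_apply T x)"
      using r by (simp add: blinfun.scaleR_right algebra_simps)
    then have "norm (y - blinfun_apply T (r *\<^sub>R x)) = r * norm (inverse r *\<^sub>R y - blinfun_apply T x)"
      using r by simp
    also have "\<dots> \<le> r * (e / 4)" using x(2) r by simp
    also have "\<dots> = norm y / 2" using e by (simp add: r_def)
    finally show ?thesis using 1 by blast
  qed
  then obtain g where g: "\<And>y. y \<in> ?R \<Longrightarrow> norm (g y) \<le> C * norm y"
    "\<And>y. y \<in> ?R \<Longrightarrow> norm (y - blinfun_apply T (g y)) \<le> norm y / 2"
    by metis
  have "\<exists>x. blinfun_apply T x = y \<and> norm x \<le> (2 * C) * norm y" if y: "y \<in> ?R" for y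
  proof -
    \<comment> \<open>\<open>Y k\<close> is the error left after \<open>k\<close> steps.\<close>
    define Y where "Y k = ((\<lambda>z. z - blinfun_apply T (g z)) ^^ k) y" for k
    have Y0: "Y 0 = y" and YS: "Y (Suc k) = Y k - blinfun_apply T (g (Y k))" for k
      by (simp_all add: Y_def)
    have YR: "Y k \<in> ?R" for k
      by (induction k) (use y diffR in \<open>auto simp: Y0 YS\<close>)
    have Yn: "norm (Y k) \<le> (1/2) ^ k * norm y" for k
    proof (induction k)
      case (Suc k)
      then show ?case using g(2)[OF YR[of k]] by (simp add: YS)
    qed (simp add: Y0)
    have xn: "norm (g (Y k)) \<le> (C * norm y) * (1/2) ^ k" for k
      using g(1)[OF YR[of k]] mult_left_mono[OF Yn[of k] C] by (simp add: mult_ac)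
    have geo: "(\<lambda>k. (C * norm y) * (1/2) ^ k) sums ((C * norm y) * 2)"
      using sums_mult[OF geometric_sums[of "1/2::real"], of "C * norm y"] by simp
    have sn: "summable (\<lambda>k. norm (g (Y k)))"
      by (rule summable_comparison_test'[OF sums_summable[OF geo], of 0]) (use xn in simp)
    then have s: "summable (\<lambda>k. g (Y k))" by (rule summable_norm_cancel)
    have "norm (\<Sum>k. g (Y k)) \<le> (\<Sum>k. norm (g (Y k)))" by (rule summable_norm[OF sn])
    also have "\<dots> \<le> (\<Sum>k. (C * norm y) * (1/2) ^ k)"
      by (rule suminf_le[OF xn sn sums_summable[OF geo]])
    also have "\<dots> = (2 * C) * norm y" using sums_unique[OF geo] by simp
    finally have bound: "norm (\<Sum>k. g (Y k)) \<le> (2 * C) * norm y" .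
    have part: "blinfun_apply T (\<Sum>k<m. g (Y k)) = y - Y m" for m
      by (induction m) (simp_all add: blinfun.zero_right blinfun.add_right Y0 YS)
    have "Y \<longlonglongrightarrow> 0"
    proof (rule tendsto_norm_zero_cancel, rule tendsto_sandwich[of "\<lambda>_. 0" _ _ "\<lambda>k. (1/2) ^ k * norm y"])
      show "(\<lambda>k. (1 / 2) ^ k * norm y) \<longlonglongrightarrow> 0"
        by (intro tendsto_mult_left_zero LIMSEQ_power_zero) simp
    qed (use Yn in auto)
    then have "(\<lambda>m. y - Y m) \<longlonglongrightarrow> y - 0" by (intro tendsto_intros)
    moreover have "(\<lambda>m. y - Y m) \<longlonglongrightarrow> blinfun_apply T (\<Sum>k. g (Y k))"
      unfolding part[symmetric] by (intro blinfun.tendsto tendsto_const summable_LIMSEQ s)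
    ultimately have "blinfun_apply T (\<Sum>k. g (Y k)) = y"
      using LIMSEQ_unique by force
    then show ?thesis using bound by blast
  qed
  then show ?thesis by blast
qed

section \<open>Parametrices\<close>

lemma finite_rank_cblinops: "finite_rank F \<Longrightarrow> F \<in> cblinops"
  by (simp add: finite_rank_def)

lemma finite_rank_iff: "finite_rank F \<longleftrightarrow> F \<in> cblinops \<and> (\<exists>B. finite B \<and> range (blinfun_apply F) \<subseteq> cspan B)"
proof
  show "finite_rank F \<Longrightarrow> F \<in> cblinops \<and> (\<exists>B. finite B \<and> range (blinfun_apply F) \<subseteq> cspan B)"
    unfolding finite_rank_def fin_quot_0_iff by blast
next
  assume "F \<in> cblinops \<and> (\<exists>B. finite B \<and> range (blinfun_apply F) \<subseteq> cspan B)"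
  then obtain B where "F \<in> cblinops" "finite B" "range (blinfun_apply F) \<subseteq> cspan B" by blast
  moreover from \<open>finite B\<close> have "fin_quot {0} (cspan B)" unfolding fin_quot_0_iff by blast
  ultimately show "finite_rank F" by (intro finite_rankI)
qed

lemma finite_rank_0: "finite_rank 0"
  by (auto simp: finite_rank_iff intro!: exI[of _ "{}"])

lemma finite_rank_add:
  assumes "finite_rank F" "finite_rank G" shows "finite_rank (F + G)"
proof -
  obtain A B where "finite A" "range (blinfun_apply F) \<subseteq> cspan A" "finite B" "range (blinfun_apply G) \<subseteq> cspan B"
    using assms by (auto simp: finite_rank_iff)
  moreover have "cspan A \<subseteq> cspan (A \<union> B)" "cspan B \<subseteq> cspan (A \<union> B)"
    by (auto intro!: complex_vector.span_mono)
  ultimately have "finite (A \<union> B)" "range (blinfun_apply (F + G)) \<subseteq> cspan (A \<union> B)"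
    by (auto simp: blinfun.add_left intro!: complex_vector.span_add)
  then show ?thesis using assms unfolding finite_rank_iff by blast
qed

lemma finite_rank_compose_right:
  assumes "finite_rank F" "A \<in> cblinops" shows "finite_rank (F o\<^sub>L A)"
proof -
  obtain B where "finite B" "range (blinfun_apply F) \<subseteq> cspan B"
    using assms by (auto simp: finite_rank_iff)
  moreover from this(2) have "range (blinfun_apply (F o\<^sub>L A)) \<subseteq> cspan B" by auto
  ultimately show ?thesis using assms unfolding finite_rank_iff by (intro conjI exI[of _ B]) simp_all
qed

lemma finite_rank_compose_left:
  assumes "finite_rank F" "A \<in> cblinops" shows "finite_rank (A o\<^sub>L F)"
proof -
  obtain B where "finite B" "range (blinfun_apply F) \<subseteq> cspan B"
    using assms by (auto simp: finite_rank_iff)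
  moreover from this(2) have "range (blinfun_apply (A o\<^sub>L F)) \<subseteq> cspan (blinfun_apply A ` B)"
    using cspan_image[OF assms(2), of B] by auto
  ultimately show ?thesis using assms unfolding finite_rank_iff by blast
qed

text \<open>Let \<open>P\<close> be a projection onto the kernel and \<open>Q\<close> one along the range. For each \<open>y\<close> the equation
\<open>T x = y - Q y\<close> has a solution, and \<open>x - P x\<close> does not depend on the solution chosen. This makes
\<open>S y = x - P x\<close> linear, and the solutions provided by the open mapping theorem make it bounded.
Then \<open>1 - S T = P\<close> and \<open>1 - T S = Q\<close>.\<close>

lemma fredholm_parametrix:
  fixes T :: "'a::cbanach \<Rightarrow>\<^sub>L 'b::cbanach"
  assumes "fredholm T"
  shows "\<exists>S\<in>cblinops. finite_rank (id_blinfun - (S o\<^sub>L T)) \<and> finite_rank (id_blinfun - (T o\<^sub>L S))"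
proof -
  let ?R = "range (blinfun_apply T)"
  have T: "T \<in> cblinops" "closed ?R" "fin_quot {0} (ker T)" "fin_quot ?R UNIV"
    using assms by (auto simp: fredholm_iff)
  obtain P where P: "finite_rank P" "range (blinfun_apply P) \<subseteq> ker T" "\<forall>x\<in>ker T. x - blinfun_apply P x = 0"
    using finite_rank_projection[OF _ T(3)] by auto
  obtain Q where Q: "finite_rank Q" "\<forall>x\<in>?R. blinfun_apply Q x = 0" "\<forall>x. x - blinfun_apply Q x \<in> ?R"
    using finite_rank_projection[OF T(2,4)] by auto
  obtain K where K: "\<And>y. y \<in> ?R \<Longrightarrow> \<exists>x. blinfun_apply T x = y \<and> norm x \<le> K * norm y"
    using open_mapping_bound[OF T(2)] by blast
  have "\<forall>y. \<exists>x. blinfun_apply T x = y - blinfun_apply Q y \<and> norm x \<le> K * norm (y - blinfun_apply Q y)"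
    using K Q(3) by blast
  then obtain h where h: "\<And>y. blinfun_apply T (h y) = y - blinfun_apply Q y"
    "\<And>y. norm (h y) \<le> K * norm (y - blinfun_apply Q y)"
    by metis
  define s where "s y = h y - blinfun_apply P (h y)" for y
  have s_eq: "s y = x - blinfun_apply P x" if "blinfun_apply T x = y - blinfun_apply Q y" for x y
  proof -
    have "h y - x \<in> ker T" using that h(1) by (simp add: ker_def blinfun.diff_right)
    then have "(h y - x) - blinfun_apply P (h y - x) = 0" using P(3) by blast
    then show ?thesis by (simp add: s_def blinfun.diff_right algebra_simps)
  qed
  have PQ: "P \<in> cblinops" "Q \<in> cblinops" using P Q by (auto intro: finite_rank_cblinops)
  have s_add: "s (x + y) = s x + s y" for x y
    using s_eq[of "h x + h y" "x + y"] h(1)[of x] h(1)[of y]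
    by (simp add: blinfun.add_right s_def algebra_simps)
  have s_scaleC: "s (c *\<^sub>C x) = c *\<^sub>C s x" for c x
    using s_eq[of "c *\<^sub>C h x" "c *\<^sub>C x"] h(1)[of x]
    by (simp add: cblinops_scaleC T PQ s_def complex_vector.scale_right_diff_distrib)
  have "bounded_linear s"
  proof (rule bounded_linear_intro[of _ "norm (id_blinfun - P) * \<bar>K\<bar> * norm (id_blinfun - Q)"])
    fix y
    have 1: "norm (s y) \<le> norm (id_blinfun - P) * norm (h y)"
      using norm_blinfun[of "id_blinfun - P" "h y"] by (simp add: s_def blinfun.diff_left)
    have 2: "norm (h y) \<le> \<bar>K\<bar> * norm (y - blinfun_apply Q y)"
      using h(2)[of y] mult_right_mono[OF abs_ge_self[of K], of "norm (y - blinfun_apply Q y)"] by simp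
    have 3: "norm (y - blinfun_apply Q y) \<le> norm (id_blinfun - Q) * norm y"
      using norm_blinfun[of "id_blinfun - Q" y] by (simp add: blinfun.diff_left)
    have "norm (s y) \<le> norm (id_blinfun - P) * (\<bar>K\<bar> * (norm (id_blinfun - Q) * norm y))"
      by (rule order_trans[OF 1 mult_left_mono[OF order_trans[OF 2 mult_left_mono[OF 3]]]]) simp_all
    then show "norm (s y) \<le> norm y * (norm (id_blinfun - P) * \<bar>K\<bar> * norm (id_blinfun - Q))"
      by (simp only: mult_ac)
  qed (simp_all add: s_add s_scaleC scaleR_scaleC)
  then have S: "blinfun_apply (Blinfun s) = s" by (rule bounded_linear_Blinfun_apply)
  have "id_blinfun - (T o\<^sub>L Blinfun s) = Q"
  proof (rule blinfun_eqI)
    fix y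
    have "blinfun_apply T (blinfun_apply P (h y)) = 0" using P(2) by (auto simp: ker_def)
    then show "blinfun_apply (id_blinfun - (T o\<^sub>L Blinfun s)) y = blinfun_apply Q y"
      by (simp add: blinfun.diff_left S s_def blinfun.diff_right h(1))
  qed
  moreover have "id_blinfun - (Blinfun s o\<^sub>L T) = P"
  proof (rule blinfun_eqI)
    fix x
    have "s (blinfun_apply T x) = x - blinfun_apply P x"
      using Q(2) by (intro s_eq) auto
    then show "blinfun_apply (id_blinfun - (Blinfun s o\<^sub>L T)) x = blinfun_apply P x"
      by (simp add: blinfun.diff_left S)
  qed
  moreover have "Blinfun s \<in> cblinops" by (simp add: cblinops_def S s_scaleC)
  ultimately show ?thesis using P(1) Q(1) by metis
qed

text \<open>The kernel of \<open>T\<close> lies in the range of \<open>1 - L T\<close>, which is finite-dimensional. The range of \<open>T\<close> contains the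
kernel of \<open>1 - T R\<close>, which is closed and has finite codimension, so the range is closed as a
finite-dimensional extension of a closed subspace. As \<open>L\<close> and \<open>R\<close> may be different operators, this also
serves to show that an operator is Fredholm from one-sided information.\<close>

lemma fredholmI:
  assumes T: "T \<in> cblinops" and L: "L \<in> cblinops" "finite_rank (id_blinfun - (L o\<^sub>L T))"
    and R: "R \<in> cblinops" "finite_rank (id_blinfun - (T o\<^sub>L R))"
  shows "fredholm T"
  unfolding fredholm_iff
proof (intro conjI T)
  let ?R = "range (blinfun_apply T)"
  have "x \<in> range (blinfun_apply (id_blinfun - (L o\<^sub>L T)))" if "x \<in> ker T" for x
    using that by (intro image_eqI[of _ _ x]) (auto simp: ker_def blinfun.diff_left blinfun.zero_right)
  then show "fin_quot {0} (ker T)"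
    using L(2) csubspace_ker[OF T] complex_vector.subspace_0[OF csubspace_ker[OF T]]
    by (intro fin_quot_between(1)[of _ _ "ker T"]) (auto simp: finite_rank_def)
  let ?F = "id_blinfun - (T o\<^sub>L R)"
  have F: "?F \<in> cblinops" using R(2) by (rule finite_rank_cblinops)
  have "fin_quot (ker ?F) UNIV"
    using fin_quot_ker[OF F, of UNIV] R(2) by (simp add: finite_rank_def)
  moreover have sub: "ker ?F \<subseteq> ?R"
    by (auto simp: ker_def blinfun.diff_left)
  ultimately have kR: "fin_quot (ker ?F) ?R" and RU: "fin_quot ?R UNIV"
    using fin_quot_between[of "ker ?F" UNIV ?R] csubspace_range[OF T] by auto
  show "fin_quot ?R UNIV" by (rule RU)
  obtain B where B: "rel_basis (ker ?F) ?R B" using kR by (auto simp: fin_quot_def)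
  have "closed (blinfun_apply ?F -` {0})"
    by (intro closed_vimage closed_singleton linear_continuous_on blinfun.bounded_linear_right)
  then have "closed (ker ?F)" by (simp add: ker_def vimage_def)
  then have "closed (cspan (ker ?F \<union> B))"
    using rel_basisD[OF B] by (intro closed_cspan_Un) auto
  then show "closed ?R" using B by (simp add: rel_basis_def)
qed

lemma fredholm_compose:
  fixes S :: "'b::cbanach \<Rightarrow>\<^sub>L 'c::cbanach" and T :: "'a::cbanach \<Rightarrow>\<^sub>L 'b"
  assumes "fredholm S" "fredholm T"
  shows "fredholm (S o\<^sub>L T)"
proof -
  obtain S' where S': "S' \<in> cblinops" "finite_rank (id_blinfun - (S' o\<^sub>L S))" "finite_rank (id_blinfun - (S o\<^sub>L S'))"
    using fredholm_parametrix[OF assms(1)] by blast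
  obtain T' where T': "T' \<in> cblinops" "finite_rank (id_blinfun - (T' o\<^sub>L T))" "finite_rank (id_blinfun - (T o\<^sub>L T'))"
    using fredholm_parametrix[OF assms(2)] by blast
  have ST: "S \<in> cblinops" "T \<in> cblinops" using assms by (auto simp: fredholm_def)
  show ?thesis
  proof (rule fredholmI)
    have "id_blinfun - ((T' o\<^sub>L S') o\<^sub>L (S o\<^sub>L T)) =
        (id_blinfun - (T' o\<^sub>L T)) + (T' o\<^sub>L ((id_blinfun - (S' o\<^sub>L S)) o\<^sub>L T))"
      by (rule blinfun_eqI) (simp add: blinfun.bilinear_simps)
    then show "finite_rank (id_blinfun - ((T' o\<^sub>L S') o\<^sub>L (S o\<^sub>L T)))"
      using S' T' ST
      by (simp only:) (intro finite_rank_add finite_rank_compose_left finite_rank_compose_right)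
    have "id_blinfun - ((S o\<^sub>L T) o\<^sub>L (T' o\<^sub>L S')) =
        (id_blinfun - (S o\<^sub>L S')) + (S o\<^sub>L ((id_blinfun - (T o\<^sub>L T')) o\<^sub>L S'))"
      by (rule blinfun_eqI) (simp add: blinfun.bilinear_simps)
    then show "finite_rank (id_blinfun - ((S o\<^sub>L T) o\<^sub>L (T' o\<^sub>L S')))"
      using S' T' ST
      by (simp only:) (intro finite_rank_add finite_rank_compose_left finite_rank_compose_right)
  qed (use S' T' ST in auto)
qed

section \<open>The index of finite-rank perturbations of the identity\<close>

lemma fredholm_id_minus_finite_rank:
  assumes "finite_rank F" shows "fredholm (id_blinfun - F)"
proof (rule fredholmI[of _ id_blinfun id_blinfun])
  have "id_blinfun - (id_blinfun o\<^sub>L (id_blinfun - F)) = F" "id_blinfun - ((id_blinfun - F) o\<^sub>L id_blinfun) = F"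
    by (rule blinfun_eqI; simp add: blinfun.bilinear_simps)+
  then show "finite_rank (id_blinfun - (id_blinfun o\<^sub>L (id_blinfun - F)))"
    "finite_rank (id_blinfun - ((id_blinfun - F) o\<^sub>L id_blinfun))"
    using assms by simp_all
qed (use finite_rank_cblinops[OF assms] in auto)

text \<open>With \<open>T = 1 - F\<close> and \<open>N = range F\<close>, the kernel of \<open>T\<close> lies in \<open>N\<close>, the space \<open>N\<close> is mapped onto
\<open>N \<inter> range T\<close>, and \<open>range T + N\<close> is the whole space. So the index can be computed within the
finite-dimensional space \<open>N\<close>, where it vanishes by the rank-nullity theorem.\<close>

lemma ind_id_minus_finite_rank:
  assumes F: "finite_rank F" shows "ind (id_blinfun - F) = 0"
proof -
  define T where "T = id_blinfun - F"
  let ?N = "range (blinfun_apply F)" and ?R = "range (blinfun_apply T)"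
  have FC: "F \<in> cblinops" and N: "fin_quot {0} ?N" using F by (auto simp: finite_rank_def)
  have "fredholm T" unfolding T_def by (rule fredholm_id_minus_finite_rank[OF F])
  then have T: "T \<in> cblinops" "fin_quot {0} (ker T)" "fin_quot ?R UNIV" by (auto simp: fredholm_iff)
  have Tx: "blinfun_apply T x = x - blinfun_apply F x" for x by (simp add: T_def blinfun.diff_left)
  note sub = csubspace_ker[OF T(1)] csubspace_range[OF FC] csubspace_range[OF T(1)]
  have ker_N: "ker T \<subseteq> ?N" by (auto simp: ker_def Tx)
  have TN: "blinfun_apply T ` ?N = ?N \<inter> ?R"
  proof
    show "blinfun_apply T ` ?N \<subseteq> ?N \<inter> ?R"
      using complex_vector.subspace_diff[OF sub(2)] by (auto simp: Tx)
    show "?N \<inter> ?R \<subseteq> blinfun_apply T ` ?N"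
    proof
      fix y assume "y \<in> ?N \<inter> ?R"
      then obtain x where x: "y = blinfun_apply T x" "y \<in> ?N" by blast
      have "y + blinfun_apply F x \<in> ?N" using x(2) by (intro complex_vector.subspace_add[OF sub(2)]) auto
      then show "y \<in> blinfun_apply T ` ?N" using x(1) by (simp add: Tx)
    qed
  qed
  have kN: "fin_quot (ker T) ?N"
    using fin_quot_between(2)[OF N sub(1)] ker_N complex_vector.subspace_0[OF sub(1)] by simp
  have "x \<in> ker T" if "blinfun_apply T x = 0" for x using that by (simp add: ker_def)
  from quotient_image[OF T(1) kN this]
  have NR: "fin_quot {0} (?N \<inter> ?R)" "qdim {0} (?N \<inter> ?R) = qdim (ker T) ?N"
    by (simp_all add: image_ker[OF T(1)] TN)
  have NRN: "fin_quot (?N \<inter> ?R) ?N"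
    using fin_quot_between(2)[OF N, of "?N \<inter> ?R"] fin_quotD[OF NR(1)] by simp
  have "cspan (?R \<union> ?N) = UNIV"
  proof -
    have "x \<in> cspan (?R \<union> ?N)" for x
    proof -
      have "blinfun_apply T x + blinfun_apply F x \<in> cspan (?R \<union> ?N)"
        by (intro complex_vector.span_add complex_vector.span_base) auto
      then show ?thesis by (simp add: Tx)
    qed
    then show ?thesis by blast
  qed
  then have "qdim ?R UNIV = qdim (?N \<inter> ?R) ?N"
    using quotient_sum(2)[OF sub(3) NRN] by simp
  moreover have "qdim {0} (ker T) + qdim (ker T) ?N = qdim {0} (?N \<inter> ?R) + qdim (?N \<inter> ?R) ?N"
    using quotient_tower(2)[OF T(2) kN] quotient_tower(2)[OF NR(1) NRN] by simp
  ultimately show ?thesis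
    using ind_eq_qdim[OF T] NR(2) by (simp add: T_def)
qed

lemma ind_left_parametrix:
  assumes "fredholm S" "fredholm T" "finite_rank (id_blinfun - (S o\<^sub>L T))"
  shows "ind S = - ind T"
proof -
  have "S o\<^sub>L T = id_blinfun - (id_blinfun - (S o\<^sub>L T))" by simp
  then have "ind (S o\<^sub>L T) = 0" using ind_id_minus_finite_rank[OF assms(3)] by metis
  then show ?thesis using ind_compose[OF assms(1,2)] by simp
qed

lemma fredholm_invertible:
  assumes "A \<in> cblinops" "B \<in> cblinops" "A o\<^sub>L B = id_blinfun" "B o\<^sub>L A = id_blinfun"
  shows "fredholm A" "ind A = 0"
proof -
  show fA: "fredholm A"
    using assms by (intro fredholmI[of A B B]) (auto simp: finite_rank_0)
  have BA: "blinfun_apply B (blinfun_apply A x) = x" for x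
    using arg_cong[OF assms(4), of "\<lambda>T. blinfun_apply T x"] by simp
  have AB: "blinfun_apply A (blinfun_apply B x) = x" for x
    using arg_cong[OF assms(3), of "\<lambda>T. blinfun_apply T x"] by simp
  have "ker A = {0}" using BA by (auto simp: ker_def blinfun.zero_right) (metis blinfun.zero_right)
  moreover have "range (blinfun_apply A) = UNIV" using AB by (metis surjI)
  ultimately show "ind A = 0"
    using fA ind_eq_qdim[of A] by (simp add: fredholm_iff qdim_refl complex_vector.subspace_single_0)
qed

section \<open>Stability of the index\<close>

text \<open>The equation \<open>x + A x = y\<close> is solved by Banach's fixed point theorem, applied to the contraction
\<open>x \<mapsto> y - A x\<close>.\<close>

lemma neumann_inverse:
  fixes A :: "'a::cbanach \<Rightarrow>\<^sub>L 'a"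
  assumes A: "A \<in> cblinops" and small: "norm A < 1"
  shows "\<exists>G\<in>cblinops. G o\<^sub>L (id_blinfun + A) = id_blinfun \<and> (id_blinfun + A) o\<^sub>L G = id_blinfun"
proof -
  have "\<exists>!x. y - blinfun_apply A x = x" for y
  proof (rule banach_fix_type)
    show "0 \<le> norm A" "norm A < 1" using small by simp_all
    have "dist (y - blinfun_apply A u) (y - blinfun_apply A v) = norm (blinfun_apply A (v - u))" for u v
      by (simp add: dist_norm blinfun.diff_right)
    then show "\<forall>u v. dist (y - blinfun_apply A u) (y - blinfun_apply A v) \<le> norm A * dist u v"
      using norm_blinfun[of A] by (metis dist_commute dist_norm)
  qed
  then have ex1: "\<exists>!x. x + blinfun_apply A x = y" for y
    by (metis add_diff_cancel_right' diff_add_cancel)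
  define g where "g y = (THE x. x + blinfun_apply A x = y)" for y
  have g_eq: "g y = x" if "x + blinfun_apply A x = y" for x y
    unfolding g_def using ex1 that by (rule the1_equality)
  have g: "g y + blinfun_apply A (g y) = y" for y
    unfolding g_def using ex1 by (rule theI')
  have add: "g (x + y) = g x + g y" for x y
    using g[of x] g[of y] by (intro g_eq) (simp add: blinfun.add_right algebra_simps)
  have scale: "g (c *\<^sub>C x) = c *\<^sub>C g x" for c x
  proof (rule g_eq)
    have "c *\<^sub>C (g x + blinfun_apply A (g x)) = c *\<^sub>C x" by (simp only: g)
    then show "c *\<^sub>C g x + blinfun_apply A (c *\<^sub>C g x) = c *\<^sub>C x"
      by (simp add: cblinops_scaleC[OF A] scaleC_add_right)
  qed
  have "bounded_linear g"
  proof (rule bounded_linear_intro[of _ "1 / (1 - norm A)"])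
    fix y
    have "norm (g y) = norm (y - blinfun_apply A (g y))"
      using g[of y] by (metis add_diff_cancel_right')
    also have "\<dots> \<le> norm y + norm (blinfun_apply A (g y))"
      by (rule norm_triangle_ineq4)
    also have "\<dots> \<le> norm y + norm A * norm (g y)" using norm_blinfun[of A "g y"] by simp
    finally show "norm (g y) \<le> norm y * (1 / (1 - norm A))"
      using small by (simp add: field_simps)
  qed (simp_all add: add scale scaleR_scaleC)
  then have G: "blinfun_apply (Blinfun g) = g" by (rule bounded_linear_Blinfun_apply)
  have "Blinfun g o\<^sub>L (id_blinfun + A) = id_blinfun"
    by (rule blinfun_eqI) (simp add: G g_eq blinfun.add_left)
  moreover have "(id_blinfun + A) o\<^sub>L Blinfun g = id_blinfun"
    by (rule blinfun_eqI) (simp add: G g blinfun.add_left)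
  moreover have "Blinfun g \<in> cblinops" by (simp add: cblinops_def G scale)
  ultimately show ?thesis by blast
qed

lemma ind_eq_of_common_left_parametrix:
  assumes "fredholm S" "fredholm T" "fredholm T'"
    and "finite_rank (id_blinfun - (S o\<^sub>L T))" "finite_rank (id_blinfun - (S o\<^sub>L T'))"
  shows "ind T' = ind T"
  using ind_left_parametrix[OF assms(1,2,4)] ind_left_parametrix[OF assms(1,3,5)] by simp

lemma fredholm_parametrixE:
  fixes T :: "'a::cbanach \<Rightarrow>\<^sub>L 'b::cbanach"
  assumes "fredholm T"
  obtains S where "fredholm S" "S \<in> cblinops" "finite_rank (id_blinfun - (S o\<^sub>L T))"
    "finite_rank (id_blinfun - (T o\<^sub>L S))"
proof -
  obtain S where "S \<in> cblinops" "finite_rank (id_blinfun - (S o\<^sub>L T))" "finite_rank (id_blinfun - (T o\<^sub>L S))"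
    using fredholm_parametrix[OF assms] by blast
  moreover have "T \<in> cblinops" using assms by (simp add: fredholm_def)
  ultimately show ?thesis using fredholmI[of S T T] that by blast
qed

text \<open>If \<open>S\<close> is a parametrix of \<open>T\<close> and \<open>D\<close> is small, then \<open>G = (1 + S D)\<^sup>-\<^sup>1\<close> and \<open>H = (1 + D S)\<^sup>-\<^sup>1\<close> exist, and
\<open>G S\<close> and \<open>S H\<close> invert \<open>T + D\<close> from the left and from the right up to finite rank. The index of \<open>T + D\<close>
is \<open>- ind (G S) = - ind S = ind T\<close>.\<close>

lemma fredholm_index_stable:
  fixes T :: "'a::cbanach \<Rightarrow>\<^sub>L 'b::cbanach"
  assumes T: "fredholm T"
  shows "\<exists>e>0. \<forall>D\<in>cblinops. norm D < e \<longrightarrow> fredholm (T + D) \<and> ind (T + D) = ind T"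
proof -
  obtain S where S: "fredholm S" "S \<in> cblinops" "finite_rank (id_blinfun - (S o\<^sub>L T))" "finite_rank (id_blinfun - (T o\<^sub>L S))"
    using fredholm_parametrixE[OF T] .
  have TC: "T \<in> cblinops" using T by (simp add: fredholm_def)
  show ?thesis
  proof (intro exI[of _ "1 / (norm S + 1)"] conjI ballI impI)
    show "0 < 1 / (norm S + 1)" by (simp add: add_nonneg_pos)
    fix D :: "'a \<Rightarrow>\<^sub>L 'b" assume D: "D \<in> cblinops" "norm D < 1 / (norm S + 1)"
    have "norm S + 1 > 0" by (simp add: add_nonneg_pos)
    then have "norm D * (norm S + 1) < 1" using D(2) by (simp only: pos_less_divide_eq)
    moreover have "norm D * norm S \<le> norm D * (norm S + 1)" by (simp add: mult_left_mono)
    ultimately have small: "norm S * norm D < 1" by (simp add: mult.commute)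
    have SD: "norm (S o\<^sub>L D) < 1" "norm (D o\<^sub>L S) < 1"
      using norm_blinfun_compose[of S D] norm_blinfun_compose[of D S] small by (simp_all add: mult.commute)
    obtain G where G: "G \<in> cblinops" "G o\<^sub>L (id_blinfun + (S o\<^sub>L D)) = id_blinfun" "(id_blinfun + (S o\<^sub>L D)) o\<^sub>L G = id_blinfun"
      using neumann_inverse[OF _ SD(1)] S(2) D(1) by auto
    obtain H where H: "H \<in> cblinops" "(id_blinfun + (D o\<^sub>L S)) o\<^sub>L H = id_blinfun"
      using neumann_inverse[OF _ SD(2)] S(2) D(1) by auto
    have "id_blinfun - ((G o\<^sub>L S) o\<^sub>L (T + D)) = (G o\<^sub>L (id_blinfun + (S o\<^sub>L D))) - ((G o\<^sub>L S) o\<^sub>L (T + D))"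
      by (simp only: G(2))
    also have "\<dots> = G o\<^sub>L (id_blinfun - (S o\<^sub>L T))"
      by (rule blinfun_eqI) (simp add: blinfun.bilinear_simps)
    finally have left: "finite_rank (id_blinfun - ((G o\<^sub>L S) o\<^sub>L (T + D)))"
      using finite_rank_compose_left[OF S(3) G(1)] by simp
    have "id_blinfun - ((T + D) o\<^sub>L (S o\<^sub>L H)) = ((id_blinfun + (D o\<^sub>L S)) o\<^sub>L H) - ((T + D) o\<^sub>L (S o\<^sub>L H))"
      by (simp only: H(2))
    also have "\<dots> = (id_blinfun - (T o\<^sub>L S)) o\<^sub>L H"
      by (rule blinfun_eqI) (simp add: blinfun.bilinear_simps)
    finally have right: "finite_rank (id_blinfun - ((T + D) o\<^sub>L (S o\<^sub>L H)))"
      using finite_rank_compose_right[OF S(4) H(1)] by simp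
    show TD: "fredholm (T + D)"
      by (rule fredholmI[OF _ _ left _ right]) (use TC D S G H in auto)
    have "fredholm G" "ind G = 0"
      using fredholm_invertible[OF G(1) _ G(2,3)] S(2) D(1) by auto
    then have "fredholm (G o\<^sub>L S)" "ind (G o\<^sub>L S) = ind S"
      using fredholm_compose[OF _ S(1), of G] ind_compose[OF _ S(1), of G] by auto
    then show "ind (T + D) = ind T"
      using ind_left_parametrix[OF _ TD left] ind_left_parametrix[OF S(1) T S(3)] by simp
  qed
qed

lemma ind_id_minus_homotopy:
  fixes K :: "'a::cbanach \<Rightarrow>\<^sub>L 'a"
  assumes K: "K \<in> cblinops" and fred: "\<And>t. t \<in> {0..1::real} \<Longrightarrow> fredholm (id_blinfun - t *\<^sub>R K)"
  shows "ind (id_blinfun - K) = 0"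
proof -
  have "ind (id_blinfun - 1 *\<^sub>R K) = ind (id_blinfun - 0 *\<^sub>R K)"
  proof (rule connected_local_const[of "{0..1::real}"])
    show "\<forall>t\<in>{0..1}. \<forall>\<^sub>F s in at t within {0..1}. ind (id_blinfun - t *\<^sub>R K) = ind (id_blinfun - s *\<^sub>R K)"
    proof
      fix t :: real assume t: "t \<in> {0..1}"
      obtain e where e: "e > 0" "\<And>D. D \<in> cblinops \<Longrightarrow> norm D < e \<Longrightarrow> ind (id_blinfun - t *\<^sub>R K + D) = ind (id_blinfun - t *\<^sub>R K)"
        using fredholm_index_stable[OF fred[OF t]] by blast
      have "((\<lambda>s. norm ((t - s) *\<^sub>R K)) \<longlongrightarrow> norm ((t - t) *\<^sub>R K)) (at t within {0..1})"
        by (intro tendsto_intros)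
      then have "\<forall>\<^sub>F s in at t within {0..1}. norm ((t - s) *\<^sub>R K) < e"
        using e(1) by (intro order_tendstoD) auto
      then show "\<forall>\<^sub>F s in at t within {0..1}. ind (id_blinfun - t *\<^sub>R K) = ind (id_blinfun - s *\<^sub>R K)"
      proof eventually_elim
        case (elim s)
        have eq: "id_blinfun - t *\<^sub>R K + (t - s) *\<^sub>R K = id_blinfun - s *\<^sub>R K"
          by (simp add: algebra_simps)
        have "ind (id_blinfun - t *\<^sub>R K + (t - s) *\<^sub>R K) = ind (id_blinfun - t *\<^sub>R K)"
          using elim K by (intro e(2)) auto
        then show ?case by (simp only: eq)
      qed
    qed
  qed auto
  moreover have "ind (id_blinfun - 0 *\<^sub>R K) = 0"
    using fredholm_invertible(2)[of "id_blinfun :: 'a \<Rightarrow>\<^sub>L 'a" id_blinfun]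
    by (simp add: blinfun_eqI)
  ultimately show ?thesis by simp
qed

lemma finite_rank_perturbation:
  fixes T :: "'a::cbanach \<Rightarrow>\<^sub>L 'b::cbanach"
  assumes T: "fredholm T" and F: "finite_rank F"
  shows "fredholm (T - F)" "ind (T - F) = ind T"
proof -
  obtain S where S: "fredholm S" "S \<in> cblinops" "finite_rank (id_blinfun - (S o\<^sub>L T))" "finite_rank (id_blinfun - (T o\<^sub>L S))"
    using fredholm_parametrixE[OF T] .
  have C: "T \<in> cblinops" "F \<in> cblinops" using T F by (auto simp: fredholm_def finite_rank_cblinops)
  have eq: "id_blinfun - (S o\<^sub>L (T - F)) = (id_blinfun - (S o\<^sub>L T)) + (S o\<^sub>L F)"
    "id_blinfun - ((T - F) o\<^sub>L S) = (id_blinfun - (T o\<^sub>L S)) + (F o\<^sub>L S)"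
    by (rule blinfun_eqI; simp add: blinfun.bilinear_simps)+
  have fr: "finite_rank (id_blinfun - (S o\<^sub>L (T - F)))" "finite_rank (id_blinfun - ((T - F) o\<^sub>L S))"
    using finite_rank_add[OF S(3) finite_rank_compose_left[OF F S(2)]]
      finite_rank_add[OF S(4) finite_rank_compose_right[OF F S(2)]] by (simp_all only: eq)
  show "fredholm (T - F)"
    by (rule fredholmI[OF _ S(2) fr(1) S(2) fr(2)]) (use C in auto)
  then show "ind (T - F) = ind T"
    using ind_eq_of_common_left_parametrix[OF S(1) T _ S(3) fr(1)] by simp
qed

section \<open>Inessential operators\<close>

text \<open>The definition of inessential operators admits \<open>t V\<close> in place of \<open>V\<close>, so the segment from \<open>1\<close> to
\<open>1 - V R\<close> consists of Fredholm operators.\<close>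

lemma inessential_index:
  fixes R :: "'a::cbanach \<Rightarrow>\<^sub>L 'b::cbanach"
  assumes R: "R \<in> inessential_ops" and V: "V \<in> cblinops"
  shows "fredholm (id_blinfun - (V o\<^sub>L R))" "ind (id_blinfun - (V o\<^sub>L R)) = 0"
proof -
  have fr: "fredholm (id_blinfun - (W o\<^sub>L R))" if "W \<in> cblinops" for W
    using R that by (simp add: inessential_ops_def)
  then show "fredholm (id_blinfun - (V o\<^sub>L R))" using V .
  show "ind (id_blinfun - (V o\<^sub>L R)) = 0"
  proof (rule ind_id_minus_homotopy)
    show "V o\<^sub>L R \<in> cblinops" using R V by (simp add: inessential_ops_def)
    fix t :: real
    have "t *\<^sub>R (V o\<^sub>L R) = (t *\<^sub>R V) o\<^sub>L R"
      by (rule blinfun_eqI) (simp add: blinfun.bilinear_simps)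
    then show "fredholm (id_blinfun - t *\<^sub>R (V o\<^sub>L R))"
      using fr[of "t *\<^sub>R V"] V by simp
  qed
qed

text \<open>Parametrices of \<open>A T\<close> and \<open>T B\<close> yield a left and a right inverse of \<open>T\<close> modulo finite rank.\<close>

lemma fredholm_if_products:
  fixes T :: "'a::cbanach \<Rightarrow>\<^sub>L 'b::cbanach" and A :: "'b \<Rightarrow>\<^sub>L 'c::cbanach" and B :: "'d::cbanach \<Rightarrow>\<^sub>L 'a"
  assumes "T \<in> cblinops" "A \<in> cblinops" "B \<in> cblinops" and AT: "fredholm (A o\<^sub>L T)" and TB: "fredholm (T o\<^sub>L B)"
  shows "fredholm T"
proof -
  obtain P where P: "P \<in> cblinops" "finite_rank (id_blinfun - (P o\<^sub>L (A o\<^sub>L T)))"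
    using fredholm_parametrix[OF AT] by blast
  obtain Q where Q: "Q \<in> cblinops" "finite_rank (id_blinfun - ((T o\<^sub>L B) o\<^sub>L Q))"
    using fredholm_parametrix[OF TB] by blast
  have "P o\<^sub>L (A o\<^sub>L T) = (P o\<^sub>L A) o\<^sub>L T" "(T o\<^sub>L B) o\<^sub>L Q = T o\<^sub>L (B o\<^sub>L Q)"
    by (rule blinfun_eqI; simp)+
  then show ?thesis
    using P Q assms by (intro fredholmI[of T "P o\<^sub>L A" "B o\<^sub>L Q"]) auto
qed

text \<open>A parametrix \<open>S\<close> of \<open>T\<close> turns \<open>T + P Q\<close> into \<open>1 + S P Q\<close> up to finite rank, which has index zero.\<close>

lemma ind_inessential_perturbation:
  fixes T :: "'a::cbanach \<Rightarrow>\<^sub>L 'a" and P :: "'b::cbanach \<Rightarrow>\<^sub>L 'a"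
  assumes T: "fredholm T" and P: "P \<in> cblinops" and Q: "Q \<in> inessential_ops"
    and TPQ: "fredholm (T + (P o\<^sub>L Q))"
  shows "ind (T + (P o\<^sub>L Q)) = ind T"
proof -
  obtain S where S: "fredholm S" "S \<in> cblinops" "finite_rank (id_blinfun - (S o\<^sub>L T))"
    using fredholm_parametrixE[OF T] by metis
  have "S o\<^sub>L (T + (P o\<^sub>L Q)) = (id_blinfun - ((- (S o\<^sub>L P)) o\<^sub>L Q)) - (id_blinfun - (S o\<^sub>L T))"
    by (rule blinfun_eqI) (simp add: blinfun.bilinear_simps)
  moreover have "fredholm (id_blinfun - ((- (S o\<^sub>L P)) o\<^sub>L Q))" "ind (id_blinfun - ((- (S o\<^sub>L P)) o\<^sub>L Q)) = 0"
    using inessential_index[OF Q, of "- (S o\<^sub>L P)"] S(2) P by auto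
  ultimately have "ind (S o\<^sub>L (T + (P o\<^sub>L Q))) = 0"
    using finite_rank_perturbation(2)[OF _ S(3)] by metis
  then show ?thesis
    using ind_compose[OF S(1) TPQ] ind_left_parametrix[OF S(1) T S(3)] by simp
qed

section \<open>Operator matrices\<close>

text \<open>The arguments are the entries of the matrix, row by row.\<close>

definition op_matrix :: "('a::real_normed_vector \<Rightarrow>\<^sub>L 'a) \<Rightarrow> ('b::real_normed_vector \<Rightarrow>\<^sub>L 'a) \<Rightarrow> ('a \<Rightarrow>\<^sub>L 'b) \<Rightarrow> ('b \<Rightarrow>\<^sub>L 'b)
    \<Rightarrow> ('a \<times> 'b) \<Rightarrow>\<^sub>L ('a \<times> 'b)"
  where "op_matrix A B C D =
    (inl_blinfun o\<^sub>L ((A o\<^sub>L fst_blinfun) + (B o\<^sub>L snd_blinfun))) + (inr_blinfun o\<^sub>L ((C o\<^sub>L fst_blinfun) + (D o\<^sub>L snd_blinfun)))"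

lemma op_matrix_apply [simp]:
  "blinfun_apply (op_matrix A B C D) (x, y) = (blinfun_apply A x + blinfun_apply B y, blinfun_apply C x + blinfun_apply D y)"
  by (simp add: op_matrix_def blinfun.add_left)

lemma blinfun_prod_eqI: "(\<And>x y. blinfun_apply S (x, y) = blinfun_apply T (x, y)) \<Longrightarrow> S = T"
  by (rule blinfun_eqI) auto

lemma op_matrix_compose:
  "op_matrix A B C D o\<^sub>L op_matrix A' B' C' D' =
    op_matrix ((A o\<^sub>L A') + (B o\<^sub>L C')) ((A o\<^sub>L B') + (B o\<^sub>L D')) ((C o\<^sub>L A') + (D o\<^sub>L C')) ((C o\<^sub>L B') + (D o\<^sub>L D'))"
  by (rule blinfun_prod_eqI) (simp add: blinfun.bilinear_simps algebra_simps)

lemma op_matrix_diff: "op_matrix A B C D - op_matrix A' B' C' D' = op_matrix (A - A') (B - B') (C - C') (D - D')"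
  by (rule blinfun_prod_eqI) (simp add: blinfun.bilinear_simps algebra_simps)

lemma op_matrix_entries: "op_matrix (entry11 U) (entry12 U) (entry21 U) (entry22 U) = U"
  by (rule blinfun_prod_eqI) (simp add: operator_matrix[of U])

lemma cblinops_coordinates [simp]:
  "fst_blinfun \<in> cblinops" "snd_blinfun \<in> cblinops" "inl_blinfun \<in> cblinops" "inr_blinfun \<in> cblinops"
  by (simp_all add: cblinops_def scaleC_prod_def)

lemma cblinops_op_matrix [simp]:
  "A \<in> cblinops \<Longrightarrow> B \<in> cblinops \<Longrightarrow> C \<in> cblinops \<Longrightarrow> D \<in> cblinops \<Longrightarrow> op_matrix A B C D \<in> cblinops"
  by (simp add: op_matrix_def)

lemma cblinops_entries [simp]:
  assumes "U \<in> cblinops"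
  shows "entry11 U \<in> cblinops" "entry12 U \<in> cblinops" "entry21 U \<in> cblinops" "entry22 U \<in> cblinops"
  using assms by (simp_all add: entry11_def entry12_def entry21_def entry22_def)

lemma finite_rank_entries:
  assumes "finite_rank F"
  shows "finite_rank (entry11 F)" "finite_rank (entry22 F)"
  using assms
  by (simp_all add: entry11_def entry22_def finite_rank_compose_left finite_rank_compose_right)

lemma entries_compose:
  "entry11 (U o\<^sub>L V) = (entry11 U o\<^sub>L entry11 V) + (entry12 U o\<^sub>L entry21 V)"
  "entry22 (U o\<^sub>L V) = (entry22 U o\<^sub>L entry22 V) + (entry21 U o\<^sub>L entry12 V)"
proof -
  have "blinfun_apply U (x, y) = (blinfun_apply (entry11 U) x + blinfun_apply (entry12 U) y,
      blinfun_apply (entry21 U) x + blinfun_apply (entry22 U) y)" for x y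
    by (rule operator_matrix)
  moreover have "blinfun_apply (entry11 (U o\<^sub>L V)) x = fst (blinfun_apply U (blinfun_apply V (x, 0)))"
    "blinfun_apply (entry22 (U o\<^sub>L V)) y = snd (blinfun_apply U (blinfun_apply V (0, y)))" for x y
    by (simp_all add: entry11_def entry22_def)
  ultimately show "entry11 (U o\<^sub>L V) = (entry11 U o\<^sub>L entry11 V) + (entry12 U o\<^sub>L entry21 V)"
    "entry22 (U o\<^sub>L V) = (entry22 U o\<^sub>L entry22 V) + (entry21 U o\<^sub>L entry12 V)"
    by (auto intro!: blinfun_eqI simp: operator_matrix[of V] blinfun.bilinear_simps)
qed

lemma entries_id_minus:
  "entry11 (id_blinfun - T) = id_blinfun - entry11 T" "entry22 (id_blinfun - T) = id_blinfun - entry22 T"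
  by (rule blinfun_eqI; simp add: entry11_def entry22_def blinfun.bilinear_simps)+

section \<open>Diagonal matrices\<close>

lemma csubspace_Times: "csubspace M \<Longrightarrow> csubspace N \<Longrightarrow> csubspace (M \<times> N)"
  unfolding complex_vector.subspace_def by (auto simp: scaleC_prod_def zero_prod_def)

lemma cspan_Times:
  assumes "csubspace M1" "csubspace M2" "csubspace L1" "csubspace L2" "M1 \<subseteq> L1" "M2 \<subseteq> L2"
  shows "cspan ((M1 \<times> M2) \<union> (L1 \<times> {0})) = L1 \<times> M2" "cspan ((M1 \<times> M2) \<union> ({0} \<times> L2)) = M1 \<times> L2"
proof -
  have zero: "0 \<in> M1" "0 \<in> M2" "0 \<in> L1" "0 \<in> L2" using assms complex_vector.subspace_0 by blast+
  show "cspan ((M1 \<times> M2) \<union> (L1 \<times> {0})) = L1 \<times> M2"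
  proof
    show "cspan ((M1 \<times> M2) \<union> (L1 \<times> {0})) \<subseteq> L1 \<times> M2"
      using assms zero by (intro complex_vector.span_minimal csubspace_Times) auto
    have "(x, y) \<in> cspan ((M1 \<times> M2) \<union> (L1 \<times> {0}))" if "x \<in> L1" "y \<in> M2" for x y
    proof -
      have "(0, y) + (x, 0) \<in> cspan ((M1 \<times> M2) \<union> (L1 \<times> {0}))"
        using that zero by (intro complex_vector.span_add complex_vector.span_base) auto
      then show ?thesis by simp
    qed
    then show "L1 \<times> M2 \<subseteq> cspan ((M1 \<times> M2) \<union> (L1 \<times> {0}))" by auto
  qed
  show "cspan ((M1 \<times> M2) \<union> ({0} \<times> L2)) = M1 \<times> L2"
  proof
    show "cspan ((M1 \<times> M2) \<union> ({0} \<times> L2)) \<subseteq> M1 \<times> L2"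
      using assms zero by (intro complex_vector.span_minimal csubspace_Times) auto
    have "(x, y) \<in> cspan ((M1 \<times> M2) \<union> ({0} \<times> L2))" if "x \<in> M1" "y \<in> L2" for x y
    proof -
      have "(x, 0) + (0, y) \<in> cspan ((M1 \<times> M2) \<union> ({0} \<times> L2))"
        using that zero by (intro complex_vector.span_add complex_vector.span_base) auto
      then show ?thesis by simp
    qed
    then show "M1 \<times> L2 \<subseteq> cspan ((M1 \<times> M2) \<union> ({0} \<times> L2))" by auto
  qed
qed

text \<open>The chain \<open>M1 \<times> M2 \<subseteq> L1 \<times> M2 \<subseteq> L1 \<times> L2\<close> has the quotients \<open>L1 / M1\<close> and \<open>L2 / M2\<close>.\<close>

lemma qdim_Times:
  fixes M1 L1 :: "'a::complex_normed_vector set" and M2 L2 :: "'b::complex_normed_vector set"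
  assumes 1: "fin_quot M1 L1" and 2: "fin_quot M2 L2"
  shows "qdim (M1 \<times> M2) (L1 \<times> L2) = qdim M1 L1 + qdim M2 L2"
proof -
  note sub = fin_quotD[OF 1] fin_quotD[OF 2]
  have zero: "0 \<in> M1" "0 \<in> M2" "0 \<in> L1" "0 \<in> L2" using sub complex_vector.subspace_0 by blast+
  have inl: "blinfun_apply (inl_blinfun :: 'a \<Rightarrow>\<^sub>L ('a \<times> 'b)) ` M = M \<times> {0}" for M by auto
  have inr: "blinfun_apply (inr_blinfun :: 'b \<Rightarrow>\<^sub>L ('a \<times> 'b)) ` M = {0} \<times> M" for M by auto
  have coord: "(inl_blinfun :: 'a \<Rightarrow>\<^sub>L ('a \<times> 'b)) \<in> cblinops" "(inr_blinfun :: 'b \<Rightarrow>\<^sub>L ('a \<times> 'b)) \<in> cblinops"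
    by simp_all
  have "fin_quot (M1 \<times> {0::'b}) (L1 \<times> {0})" "qdim (M1 \<times> {0::'b}) (L1 \<times> {0}) = qdim M1 L1"
    using quotient_image[OF coord(1) 1] zero unfolding inl by (auto simp: zero_prod_def)
  moreover have "(L1 \<times> {0}) \<inter> (M1 \<times> M2) = M1 \<times> {0}" using sub zero by auto
  ultimately have A: "fin_quot (M1 \<times> M2) (L1 \<times> M2)" "qdim (M1 \<times> M2) (L1 \<times> M2) = qdim M1 L1"
    using quotient_sum[OF csubspace_Times[OF sub(1,4)], of "L1 \<times> {0}"] cspan_Times(1)[of M1 M2 L1 L2] sub by simp_all
  have "fin_quot ({0::'a} \<times> M2) ({0} \<times> L2)" "qdim ({0::'a} \<times> M2) ({0} \<times> L2) = qdim M2 L2"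
    using quotient_image[OF coord(2) 2] zero unfolding inr by (auto simp: zero_prod_def)
  moreover have "({0} \<times> L2) \<inter> (L1 \<times> M2) = {0} \<times> M2" using sub zero by auto
  ultimately have B: "fin_quot (L1 \<times> M2) (L1 \<times> L2)" "qdim (L1 \<times> M2) (L1 \<times> L2) = qdim M2 L2"
    using quotient_sum[OF csubspace_Times[OF sub(2,4)], of "{0} \<times> L2"] cspan_Times(2)[of L1 M2 L1 L2] sub by simp_all
  show ?thesis using quotient_tower(2)[OF A(1) B(1)] A(2) B(2) by simp
qed

lemma fredholm_diagonal:
  fixes A :: "'a::cbanach \<Rightarrow>\<^sub>L 'a" and B :: "'b::cbanach \<Rightarrow>\<^sub>L 'b"
  assumes A: "fredholm A" and B: "fredholm B"
  shows "fredholm (op_matrix A 0 0 B)" "ind (op_matrix A 0 0 B) = ind A + ind B"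
proof -
  obtain A' where A': "A' \<in> cblinops" "finite_rank (id_blinfun - (A' o\<^sub>L A))" "finite_rank (id_blinfun - (A o\<^sub>L A'))"
    using fredholm_parametrix[OF A] by blast
  obtain B' where B': "B' \<in> cblinops" "finite_rank (id_blinfun - (B' o\<^sub>L B))" "finite_rank (id_blinfun - (B o\<^sub>L B'))"
    using fredholm_parametrix[OF B] by blast
  have C: "A \<in> cblinops" "B \<in> cblinops" using A B by (auto simp: fredholm_def)
  have diag: "finite_rank (op_matrix F 0 0 G)" if "finite_rank F" "finite_rank G"
    for F :: "'a \<Rightarrow>\<^sub>L 'a" and G :: "'b \<Rightarrow>\<^sub>L 'b"
    using that by (simp add: op_matrix_def finite_rank_add finite_rank_compose_left finite_rank_compose_right)
  have "id_blinfun - (op_matrix A' 0 0 B' o\<^sub>L op_matrix A 0 0 B) = op_matrix (id_blinfun - (A' o\<^sub>L A)) 0 0 (id_blinfun - (B' o\<^sub>L B))"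
    "id_blinfun - (op_matrix A 0 0 B o\<^sub>L op_matrix A' 0 0 B') = op_matrix (id_blinfun - (A o\<^sub>L A')) 0 0 (id_blinfun - (B o\<^sub>L B'))"
    by (rule blinfun_prod_eqI; simp add: blinfun.bilinear_simps)+
  then show fr: "fredholm (op_matrix A 0 0 B)"
    using diag A' B' C by (intro fredholmI[of _ "op_matrix A' 0 0 B'" "op_matrix A' 0 0 B'"]) simp_all
  have ker: "ker (op_matrix A 0 0 B) = ker A \<times> ker B" by (auto simp: ker_def zero_prod_def)
  have ran: "range (blinfun_apply (op_matrix A 0 0 B)) = range (blinfun_apply A) \<times> range (blinfun_apply B)"
  proof
    show "range (blinfun_apply (op_matrix A 0 0 B)) \<subseteq> range (blinfun_apply A) \<times> range (blinfun_apply B)" by auto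
    show "range (blinfun_apply A) \<times> range (blinfun_apply B) \<subseteq> range (blinfun_apply (op_matrix A 0 0 B))"
    proof (rule subsetI)
      fix z assume "z \<in> range (blinfun_apply A) \<times> range (blinfun_apply B)"
      then obtain x y where "z = blinfun_apply (op_matrix A 0 0 B) (x, y)" by auto
      then show "z \<in> range (blinfun_apply (op_matrix A 0 0 B))" by blast
    qed
  qed
  show "ind (op_matrix A 0 0 B) = ind A + ind B"
    using A B fr ind_eq_qdim[of A] ind_eq_qdim[of B] ind_eq_qdim[of "op_matrix A 0 0 B"]
      qdim_Times[of "{0}" "ker A" "{0}" "ker B"] qdim_Times[of "range (blinfun_apply A)" UNIV "range (blinfun_apply B)" UNIV]
    by (simp add: fredholm_iff ker ran zero_prod_def)
qed

text \<open>The matrix factors as \<open>(1 0; B 1) (1 0; 0 1 - B A) (1 A; 0 1)\<close> with invertible outer factors.\<close>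

lemma ind_unit_diagonal_matrix:
  fixes A :: "'b::cbanach \<Rightarrow>\<^sub>L 'a::cbanach" and B :: "'a \<Rightarrow>\<^sub>L 'b"
  assumes A: "A \<in> inessential_ops" and B: "B \<in> cblinops"
  shows "fredholm (op_matrix id_blinfun A B id_blinfun)" "ind (op_matrix id_blinfun A B id_blinfun) = 0"
proof -
  have AC: "A \<in> cblinops" using A by (simp add: inessential_ops_def)
  let ?L = "\<lambda>B. op_matrix id_blinfun 0 B id_blinfun :: ('a \<times> 'b) \<Rightarrow>\<^sub>L ('a \<times> 'b)"
  let ?U = "\<lambda>A. op_matrix id_blinfun A 0 id_blinfun :: ('a \<times> 'b) \<Rightarrow>\<^sub>L ('a \<times> 'b)"
  let ?D = "op_matrix id_blinfun 0 0 (id_blinfun - (B o\<^sub>L A)) :: ('a \<times> 'b) \<Rightarrow>\<^sub>L ('a \<times> 'b)"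
  have L: "fredholm (?L B)" "ind (?L B) = 0"
    by (rule fredholm_invertible[of _ "?L (- B)"];
        auto simp: B intro!: blinfun_prod_eqI simp: blinfun.bilinear_simps)+
  have U: "fredholm (?U A)" "ind (?U A) = 0"
    by (rule fredholm_invertible[of _ "?U (- A)"];
        auto simp: AC intro!: blinfun_prod_eqI simp: blinfun.bilinear_simps)+
  have id: "fredholm (id_blinfun :: 'a \<Rightarrow>\<^sub>L 'a)" "ind (id_blinfun :: 'a \<Rightarrow>\<^sub>L 'a) = 0"
    by (rule fredholm_invertible[of _ id_blinfun]; auto intro!: blinfun_eqI)+
  have D: "fredholm ?D" "ind ?D = 0"
    using fredholm_diagonal[OF id(1) inessential_index(1)[OF A B]] id(2) inessential_index(2)[OF A B] by simp_all
  have "op_matrix id_blinfun A B id_blinfun = ?L B o\<^sub>L (?D o\<^sub>L ?U A)"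
    by (rule blinfun_prod_eqI) (simp add: blinfun.bilinear_simps)
  then show "fredholm (op_matrix id_blinfun A B id_blinfun)" "ind (op_matrix id_blinfun A B id_blinfun) = 0"
    using fredholm_compose[OF L(1) fredholm_compose[OF D(1) U(1)]] ind_compose[OF L(1) fredholm_compose[OF D(1) U(1)]]
      ind_compose[OF D(1) U(1)] L D U by simp_all
qed

section \<open>Essentially incomparable summands\<close>

text \<open>The hypotheses state that the products of the matrices \<open>U\<close> and \<open>V\<close> agree with the identity in the upper
left corner up to finite rank. Formulated in terms of the entries, the lemma applies to the lower
right corner, too, with the roles of the two spaces exchanged.\<close>

lemma fredholm_corner:
  fixes U11 V11 :: "'a::cbanach \<Rightarrow>\<^sub>L 'a" and U12 V12 :: "'b::cbanach \<Rightarrow>\<^sub>L 'a" and U21 V21 :: "'a \<Rightarrow>\<^sub>L 'b"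
  assumes inc: "(cblinops :: ('a \<Rightarrow>\<^sub>L 'b) set) = inessential_ops"
    and C: "U11 \<in> cblinops" "V11 \<in> cblinops" "U12 \<in> cblinops" "V12 \<in> cblinops" "U21 \<in> cblinops" "V21 \<in> cblinops"
    and left: "finite_rank (id_blinfun - ((V11 o\<^sub>L U11) + (V12 o\<^sub>L U21)))"
    and right: "finite_rank (id_blinfun - ((U11 o\<^sub>L V11) + (U12 o\<^sub>L V21)))"
  shows "fredholm U11"
proof (rule fredholm_if_products[OF C(1,2,2)])
  have "fredholm (id_blinfun - (V12 o\<^sub>L U21))" "fredholm (id_blinfun - (U12 o\<^sub>L V21))"
    using inessential_index(1) C inc by blast+
  from finite_rank_perturbation(1)[OF this(1) left] finite_rank_perturbation(1)[OF this(2) right]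
  show "fredholm (V11 o\<^sub>L U11)" "fredholm (U11 o\<^sub>L V11)"
    by (simp_all add: algebra_simps)
qed

lemma fredholm_entries:
  fixes U :: "('x::cbanach \<times> 'y::cbanach) \<Rightarrow>\<^sub>L ('x \<times> 'y)"
  assumes inc: "essentially_incomparable TYPE('x) TYPE('y)" and U: "fredholm U"
  shows "fredholm (entry11 U)" "fredholm (entry22 U)"
proof -
  obtain V where V: "V \<in> cblinops" "finite_rank (id_blinfun - (V o\<^sub>L U))" "finite_rank (id_blinfun - (U o\<^sub>L V))"
    using fredholm_parametrix[OF U] by blast
  have UC: "U \<in> cblinops" using U by (simp add: fredholm_def)
  have I: "(cblinops :: ('x \<Rightarrow>\<^sub>L 'y) set) = inessential_ops" "(cblinops :: ('y \<Rightarrow>\<^sub>L 'x) set) = inessential_ops"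
    using inc by (auto simp: essentially_incomparable_def)
  note fr = finite_rank_entries[OF V(2)] finite_rank_entries[OF V(3)]
  show "fredholm (entry11 U)"
    using fr UC V(1)
    by (intro fredholm_corner[OF I(1), of _ "entry11 V" "entry12 U" "entry12 V" "entry21 U" "entry21 V"])
      (simp_all add: entries_id_minus entries_compose)
  show "fredholm (entry22 U)"
    using fr UC V(1)
    by (intro fredholm_corner[OF I(2), of _ "entry22 V" "entry21 U" "entry21 V" "entry12 U" "entry12 V"])
      (simp_all add: entries_id_minus entries_compose)
qed

text \<open>Multiplying \<open>U\<close> from the left by the diagonal matrix of parametrices of \<open>U11\<close> and \<open>U22\<close> gives a
matrix with unit diagonal up to finite rank, and thus an operator of index zero.\<close>

lemma ind_entries:
  fixes U :: "('x::cbanach \<times> 'y::cbanach) \<Rightarrow>\<^sub>L ('x \<times> 'y)"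
  assumes inc: "essentially_incomparable TYPE('x) TYPE('y)" and U: "fredholm U"
  shows "ind U = ind (entry11 U) + ind (entry22 U)"
proof -
  have UC: "U \<in> cblinops" using U by (simp add: fredholm_def)
  obtain W where W: "fredholm W" "W \<in> cblinops" "finite_rank (id_blinfun - (W o\<^sub>L entry11 U))"
    using fredholm_parametrixE[OF fredholm_entries(1)[OF assms]] by metis
  obtain S where S: "fredholm S" "S \<in> cblinops" "finite_rank (id_blinfun - (S o\<^sub>L entry22 U))"
    using fredholm_parametrixE[OF fredholm_entries(2)[OF assms]] by metis
  let ?D = "op_matrix W 0 0 S" and ?N = "op_matrix id_blinfun (W o\<^sub>L entry12 U) (S o\<^sub>L entry21 U) id_blinfun"
  let ?F = "op_matrix (id_blinfun - (W o\<^sub>L entry11 U)) 0 0 (id_blinfun - (S o\<^sub>L entry22 U))"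
  have "?D o\<^sub>L U = ?D o\<^sub>L op_matrix (entry11 U) (entry12 U) (entry21 U) (entry22 U)"
    by (simp only: op_matrix_entries)
  also have "\<dots> = ?N - ?F" by (simp add: op_matrix_compose op_matrix_diff)
  finally have DU: "?D o\<^sub>L U = ?N - ?F" .
  have F: "finite_rank ?F"
    using W(3) S(3) by (simp add: op_matrix_def finite_rank_add finite_rank_compose_left finite_rank_compose_right)
  have "(cblinops :: ('y \<Rightarrow>\<^sub>L 'x) set) = inessential_ops"
    using inc by (simp add: essentially_incomparable_def)
  moreover have "W o\<^sub>L entry12 U \<in> cblinops" "S o\<^sub>L entry21 U \<in> cblinops"
    using W(2) S(2) UC by simp_all
  ultimately have N: "fredholm ?N" "ind ?N = 0"
    using ind_unit_diagonal_matrix[of "W o\<^sub>L entry12 U" "S o\<^sub>L entry21 U"] by blast+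
  have "ind ?D + ind U = 0"
    using ind_compose[OF fredholm_diagonal(1)[OF W(1) S(1)] U] finite_rank_perturbation(2)[OF N(1) F] N(2)
    by (simp add: DU)
  then show ?thesis
    using fredholm_diagonal(2)[OF W(1) S(1)]
      ind_left_parametrix[OF W(1) fredholm_entries(1)[OF assms] W(3)]
      ind_left_parametrix[OF S(1) fredholm_entries(2)[OF assms] S(3)] by simp
qed

section \<open>The group of invertible operators\<close>

lemma carrier_Inv: "carrier Inv = {U \<in> cblinops. \<exists>V\<in>cblinops. V o\<^sub>L U = id_blinfun \<and> U o\<^sub>L V = id_blinfun}"
  by (simp add: Inv_def units_of_def Units_def op_monoid_def)

lemma group_Inv: "group Inv"
  unfolding Inv_def
proof (rule monoid.units_group)
  show "Group.monoid op_monoid"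
    by (rule Group.monoidI) (auto simp: op_monoid_def intro!: blinfun_eqI)
qed

lemma mult_Inv: "mult Inv = (o\<^sub>L)"
  by (simp add: Inv_def units_of_def op_monoid_def)

lemma fredholm_Inv: "U \<in> carrier Inv \<Longrightarrow> fredholm U"
  using fredholm_invertible(1) by (auto simp: carrier_Inv)

theorem proposition8p3:
  assumes "essentially_incomparable TYPE('x::cbanach) TYPE('y::cbanach)"
  shows "(\<forall>U :: ('x \<times> 'y) \<Rightarrow>\<^sub>L ('x \<times> 'y). fredholm U \<longrightarrow>
            fredholm (entry11 U) \<and> fredholm (entry22 U) \<and>
            ind U = ind (entry11 U) + ind (entry22 U))
       \<and> group_hom (Inv :: (('x \<times> 'y) \<Rightarrow>\<^sub>L ('x \<times> 'y)) monoid) integer_group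
            (\<lambda>U. ind (entry11 U))
       \<and> continuous_map
            (top_of_set (carrier (Inv :: (('x \<times> 'y) \<Rightarrow>\<^sub>L ('x \<times> 'y)) monoid)))
            (discrete_topology (UNIV :: int set))
            (\<lambda>U. ind (entry11 U))"
proof (intro conjI allI impI)
  fix U :: "('x \<times> 'y) \<Rightarrow>\<^sub>L ('x \<times> 'y)" assume U: "fredholm U"
  show "fredholm (entry11 U)" "fredholm (entry22 U)" "ind U = ind (entry11 U) + ind (entry22 U)"
    using fredholm_entries[OF assms U] ind_entries[OF assms U] by auto
next
  let ?G = "Inv :: (('x \<times> 'y) \<Rightarrow>\<^sub>L ('x \<times> 'y)) monoid"
  show "group_hom ?G integer_group (\<lambda>U. ind (entry11 U))"
  proof (intro group_hom.intro group_hom_axioms.intro group_Inv group_integer_group homI)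
    fix U V assume UV: "U \<in> carrier ?G" "V \<in> carrier ?G"
    have "U o\<^sub>L V \<in> carrier ?G"
      using group.is_monoid[OF group_Inv] monoid.m_closed[of ?G U V] UV by (simp add: mult_Inv)
    then have fr: "fredholm (entry11 U)" "fredholm (entry11 V)" "fredholm (entry11 (U o\<^sub>L V))"
      using fredholm_entries(1)[OF assms fredholm_Inv] UV by blast+
    have C: "U \<in> cblinops" "V \<in> cblinops" using UV by (auto simp: carrier_Inv)
    \<comment> \<open>The upper left entry of \<open>U V\<close> differs from \<open>U11 V11\<close> by \<open>U12 V21\<close>.\<close>
    have "entry21 V \<in> inessential_ops"
      using assms cblinops_entries(3)[OF C(2)] by (simp add: essentially_incomparable_def)
    then have "ind (entry11 (U o\<^sub>L V)) = ind (entry11 U o\<^sub>L entry11 V)"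
      using ind_inessential_perturbation[OF fredholm_compose[OF fr(1,2)] cblinops_entries(2)[OF C(1)]] fr(3)
      by (simp add: entries_compose)
    then show "ind (entry11 (U \<otimes>\<^bsub>?G\<^esub> V)) = ind (entry11 U) \<otimes>\<^bsub>integer_group\<^esub> ind (entry11 V)"
      using ind_compose[OF fr(1,2)] by (simp add: mult_Inv)
  qed simp
next
  let ?C = "carrier (Inv :: (('x \<times> 'y) \<Rightarrow>\<^sub>L ('x \<times> 'y)) monoid)"
  have loc: "\<exists>d>0. \<forall>V\<in>?C. dist V U < d \<longrightarrow> ind (entry11 V) = ind (entry11 U)" if U: "U \<in> ?C" for U
  proof -
    obtain e where e: "e > 0" "\<And>D. D \<in> cblinops \<Longrightarrow> norm D < e \<Longrightarrow> ind (entry11 U + D) = ind (entry11 U)"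
      using fredholm_index_stable[OF fredholm_entries(1)[OF assms fredholm_Inv[OF U]]] by blast
    have "continuous (at U) (\<lambda>V. entry11 V)"
      unfolding entry11_def by (intro continuous_intros)
    then obtain d where d: "d > 0" "\<And>V. dist V U < d \<Longrightarrow> dist (entry11 V) (entry11 U) < e"
      using e(1) by (auto simp: continuous_at_eps_delta)
    have "ind (entry11 V) = ind (entry11 U)" if "V \<in> ?C" "dist V U < d" for V
      using e(2)[of "entry11 V - entry11 U"] d(2)[OF that(2)] that(1) U
      by (simp add: carrier_Inv dist_norm)
    then show ?thesis using d(1) by blast
  qed
  show "continuous_map (top_of_set ?C) (discrete_topology (UNIV :: int set)) (\<lambda>U. ind (entry11 U))"
    unfolding continuous_map_def
  proof (intro conjI allI impI)
    fix S :: "int set"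
    show "openin (top_of_set ?C) {U \<in> topspace (top_of_set ?C). ind (entry11 U) \<in> S}"
      unfolding openin_euclidean_subtopology_iff
    proof (intro conjI ballI)
      fix U assume "U \<in> {U \<in> topspace (top_of_set ?C). ind (entry11 U) \<in> S}"
      then have U: "U \<in> ?C" "ind (entry11 U) \<in> S" by simp_all
      obtain d where d: "d > 0" "\<forall>V\<in>?C. dist V U < d \<longrightarrow> ind (entry11 V) = ind (entry11 U)"
        using loc[OF U(1)] by blast
      then show "\<exists>d>0. \<forall>V\<in>?C. dist V U < d \<longrightarrow> V \<in> {U \<in> topspace (top_of_set ?C). ind (entry11 U) \<in> S}"
        using U(2) by (intro exI[of _ d]) simp
    qed simp
  qed simp
qed

end
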